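(* Let $\alpha_i,\beta_i,\gamma_i\in\mathbb{C}$ ($i=0,1,2$) with $(\gamma_1,\gamma_2)\neq(0,0)$ be such that $$f(x_1,x_2)=\left(\alpha_0+\alpha_1x_1+\alpha_2x_2,\ \frac{\beta_0+\beta_1x_1+\beta_2x_2}{\gamma_0+\gamma_1x_1+\gamma_2x_2}\right)$$ is birational, suppose $\alpha_1\gamma_2-\alpha_2\gamma_1=0$, and suppose that $f$ has zero algebraic entropy. Then after an affine change of coordinates (and renaming the parameters) $f$ can be written as $$f(x,y)=\left(\alpha_0+\alpha_1x,\ \frac{\beta_0+y}{x}\right),\qquad \alpha_1\neq0 .$$ This map preserves the fibration $V(x,y)=x$, and this fibration is unique. If $m(x):=\alpha_0+\alpha_1x$ is periodic of period $p$, that is, if $\alpha_1^p=1$ for some $p>1$, $\alpha_1\neq1$, then $$W(x,y)=x\cdot m(x)\cdot m(m(x))\cdots m^{p-1}(x)$$ is a first integral of $f(x,y)$. Also, when $\alpha_1=1$ and $\alpha_0=0$, $f$ is integrable.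
   Context: A map $f:\mathbb{C}^2\to\mathbb{C}^2$ with rational components is birational if there exist an algebraic curve $V$ and a rational map $g$ with $f\circ g=g\circ f=\mathrm{id}$ on $\mathbb{C}^2\setminus V$. Let $F:\mathbb{P}^2(\mathbb{C})\to\mathbb{P}^2(\mathbb{C})$ be the extension of $f$ via $(x_1,x_2)\mapsto[1:x_1:x_2]$; $\deg(F^n)$ is the degree of the components of $F^n$ after removing common factors. The dynamical degree is $\delta(F)=\lim_{n\to\infty}(\deg(F^n))^{1/n}$ and the algebraic entropy is $\log\delta(F)$. $m^{j}$ denotes the $j$-th iterate of $m$. A fibration given by a nonconstant rational function $V$ is preserved by (invariant under) $f$ if $f$ maps level curves of $V$ to level curves of $V$, i.e. $V\circ f=\varphi\circ V$ for some Möbius map $\varphi$; uniqueness means that $f$ preserves no other fibration (fibrations being identified when they have the same fibres). A first integral is a nonconstant rational function $W$ with $W\circ f=W$; $f$ is integrable if it has a first integral. *)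

theory Defs
  imports Complex_Main "HOL-Computational_Algebra.Computational_Algebra"
    "HOL-Computational_Algebra.Field_as_Ring"
begin

subsection \<open>Algebraic curves and rational functions on the affine plane\<close>

text \<open>
  The ring \<open>\<complex>[x,y]\<close> is \<^typ>\<open>complex poly poly\<close>; the inner variable is \<open>x\<close>, the outer one is \<open>y\<close>.
\<close>

definition eval2 :: "complex poly poly \<Rightarrow> complex \<times> complex \<Rightarrow> complex" where
  "eval2 P z = poly (poly P [:snd z:]) (fst z)"

definition zero_set :: "complex poly poly \<Rightarrow> (complex \<times> complex) set" where
  "zero_set P = {z. eval2 P z = 0}"

definition const2 :: "complex \<Rightarrow> complex poly poly" where
  "const2 c = [:[:c:]:]"

definition algebraic_curve :: "(complex \<times> complex) set \<Rightarrow> bool" where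
  "algebraic_curve V \<longleftrightarrow> (\<exists>P. P \<notin> range const2 \<and> V = zero_set P)"

definition off_curve :: "(complex \<times> complex \<Rightarrow> bool) \<Rightarrow> bool" where
  "off_curve R \<longleftrightarrow> (\<exists>V. algebraic_curve V \<and> (\<forall>z. z \<notin> V \<longrightarrow> R z))"

text \<open>
  Rational functions and maps are represented by total functions whose values matter only off a
  curve: on the polar set they are arbitrary (for instance those produced by \<open>u / 0 = 0\<close>).
  Accordingly, identities between rational functions are stated off a curve.
\<close>

definition represents ::
  "complex poly poly \<Rightarrow> complex poly poly \<Rightarrow> (complex \<times> complex \<Rightarrow> complex) \<Rightarrow> bool" where
  "represents P Q u \<longleftrightarrow> Q \<noteq> 0 \<and> off_curve (\<lambda>z. u z = eval2 P z / eval2 Q z)"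

definition rational_function :: "(complex \<times> complex \<Rightarrow> complex) \<Rightarrow> bool" where
  "rational_function u \<longleftrightarrow> (\<exists>P Q. represents P Q u)"

definition nonconstant :: "(complex \<times> complex \<Rightarrow> complex) \<Rightarrow> bool" where
  "nonconstant u \<longleftrightarrow> \<not> (\<exists>c. off_curve (\<lambda>z. u z = c))"

type_synonym plane_map = "complex \<times> complex \<Rightarrow> complex \<times> complex"

definition rational_map :: "plane_map \<Rightarrow> bool" where
  "rational_map f \<longleftrightarrow> rational_function (fst \<circ> f) \<and> rational_function (snd \<circ> f)"

text \<open>
  The arbitrary values of \<open>f\<close> on its polar set are harmless here: \<open>f (g z) = z\<close> off a curve makes
  the rational map \<open>g\<close> injective off a curve, so its image lies in no curve.
\<close>

definition birational :: "plane_map \<Rightarrow> bool" where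
  "birational f \<longleftrightarrow> rational_map f \<and>
     (\<exists>g V. rational_map g \<and> algebraic_curve V \<and> (\<forall>z. z \<notin> V \<longrightarrow> f (g z) = z \<and> g (f z) = z))"

definition affine_change :: "plane_map \<Rightarrow> bool" where
  "affine_change A \<longleftrightarrow>
     (\<exists>a b c d r s. a * d - b * c \<noteq> 0 \<and> A = (\<lambda>(x, y). (a * x + b * y + r, c * x + d * y + s)))"


subsection \<open>Degrees of projective extensions and algebraic entropy\<close>

text \<open>
  The ring \<open>\<complex>[x\<^sub>0,x\<^sub>1,x\<^sub>2]\<close> is \<^typ>\<open>complex poly poly poly\<close>, with \<open>x\<^sub>0\<close> innermost and \<open>x\<^sub>2\<close> outermost.
  A rational self-map \<open>[F\<^sub>0 : F\<^sub>1 : F\<^sub>2]\<close> of the projective plane is a triple of such polynomials,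
  homogeneous of the same degree; common factors are allowed in the triple and are removed
  when its degree is taken.
\<close>

type_synonym poly3 = "complex poly poly poly"
type_synonym proj_map = "poly3 \<times> poly3 \<times> poly3"

definition coeff3 :: "poly3 \<Rightarrow> nat \<Rightarrow> nat \<Rightarrow> nat \<Rightarrow> complex" where
  "coeff3 P i j k = coeff (coeff (coeff P k) j) i"

definition eval3 :: "poly3 \<Rightarrow> complex \<Rightarrow> complex \<Rightarrow> complex \<Rightarrow> complex" where
  "eval3 P a b c = poly (poly (poly P [:[:c:]:]) [:b:]) a"

definition homogeneous :: "nat \<Rightarrow> poly3 \<Rightarrow> bool" where
  "homogeneous d P \<longleftrightarrow> (\<forall>i j k. coeff3 P i j k \<noteq> 0 \<longrightarrow> i + j + k = d)"

definition total_degree :: "poly3 \<Rightarrow> nat" where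
  "total_degree P = Max (insert 0 {i + j + k | i j k. coeff3 P i j k \<noteq> 0})"

definition subst3 :: "proj_map \<Rightarrow> poly3 \<Rightarrow> poly3" where
  "subst3 = (\<lambda>(F0, F1, F2) P.
     poly (map_poly (\<lambda>q. poly (map_poly (\<lambda>r. poly (map_poly (\<lambda>c. [:[:[:c:]:]:]) r) F0) q) F1) P) F2)"

definition proj_comp :: "proj_map \<Rightarrow> proj_map \<Rightarrow> proj_map" where
  "proj_comp = (\<lambda>(G0, G1, G2) F. (subst3 F G0, subst3 F G1, subst3 F G2))"

definition proj_id :: proj_map where
  "proj_id = ([:[:[:0, 1:]:]:], [:[:0, 1:]:], [:0, 1:])"

definition proj_iterate :: "proj_map \<Rightarrow> nat \<Rightarrow> proj_map" where
  "proj_iterate F n = (proj_comp F ^^ n) proj_id"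

definition proj_degree :: "proj_map \<Rightarrow> nat" where
  "proj_degree = (\<lambda>(F0, F1, F2). let h = gcd F0 (gcd F1 F2) in
     Max {total_degree (F0 div h), total_degree (F1 div h), total_degree (F2 div h)})"

definition proj_extension :: "plane_map \<Rightarrow> proj_map \<Rightarrow> bool" where
  "proj_extension f = (\<lambda>(F0, F1, F2).
     (\<exists>d. homogeneous d F0 \<and> homogeneous d F1 \<and> homogeneous d F2) \<and>
     off_curve (\<lambda>(x, y). eval3 F0 1 x y \<noteq> 0 \<and>
       f (x, y) = (eval3 F1 1 x y / eval3 F0 1 x y, eval3 F2 1 x y / eval3 F0 1 x y)))"

definition has_dynamical_degree :: "proj_map \<Rightarrow> real \<Rightarrow> bool" where
  "has_dynamical_degree F \<delta> \<longleftrightarrow>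
     (\<lambda>n. root n (real (proj_degree (proj_iterate F n)))) \<longlonglongrightarrow> \<delta>"

definition has_algebraic_entropy :: "plane_map \<Rightarrow> real \<Rightarrow> bool" where
  "has_algebraic_entropy f h \<longleftrightarrow>
     (\<exists>F \<delta>. proj_extension f F \<and> has_dynamical_degree F \<delta> \<and> h = ln \<delta>)"


subsection \<open>Invariant fibrations and first integrals\<close>

definition preserves_fibration :: "plane_map \<Rightarrow> (complex \<times> complex \<Rightarrow> complex) \<Rightarrow> bool" where
  "preserves_fibration f V \<longleftrightarrow> rational_function V \<and> nonconstant V \<and>
     (\<exists>a b c d. a * d - b * c \<noteq> 0 \<and> off_curve (\<lambda>z. V (f z) = (a * V z + b) / (c * V z + d)))"

text \<open>
  The fibres of the fibration given by \<open>V = P / Q\<close> are the irreducible components of the level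
  curves \<open>{s P = t Q}\<close> with \<open>[s : t]\<close> in the projective line. Taking whole level curves instead
  would distinguish \<open>V\<close> from \<open>V\<^sup>2\<close>, which define the same fibration.
\<close>

definition fibres :: "(complex \<times> complex \<Rightarrow> complex) \<Rightarrow> (complex \<times> complex) set set" where
  "fibres V = {zero_set h | h P Q s t.
     represents P Q V \<and> coprime P Q \<and> (s, t) \<noteq> (0, 0) \<and>
     irreducible h \<and> h dvd const2 s * P - const2 t * Q}"

definition unique_invariant_fibration ::
  "plane_map \<Rightarrow> (complex \<times> complex \<Rightarrow> complex) \<Rightarrow> bool" where
  "unique_invariant_fibration f V \<longleftrightarrow>
     preserves_fibration f V \<and> (\<forall>U. preserves_fibration f U \<longrightarrow> fibres U = fibres V)"

definition first_integral :: "plane_map \<Rightarrow> (complex \<times> complex \<Rightarrow> complex) \<Rightarrow> bool" where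
  "first_integral f W \<longleftrightarrow> rational_function W \<and> nonconstant W \<and> off_curve (\<lambda>z. W (f z) = W z)"

definition integrable :: "plane_map \<Rightarrow> bool" where
  "integrable f \<longleftrightarrow> (\<exists>W. first_integral f W)"


subsection \<open>The family and its normal form\<close>

definition family_map ::
  "(nat \<Rightarrow> complex) \<Rightarrow> (nat \<Rightarrow> complex) \<Rightarrow> (nat \<Rightarrow> complex) \<Rightarrow> plane_map" where
  "family_map \<alpha> \<beta> \<gamma> = (\<lambda>(x1, x2).
     (\<alpha> 0 + \<alpha> 1 * x1 + \<alpha> 2 * x2,
      (\<beta> 0 + \<beta> 1 * x1 + \<beta> 2 * x2) / (\<gamma> 0 + \<gamma> 1 * x1 + \<gamma> 2 * x2)))"

definition normal_form :: "complex \<Rightarrow> complex \<Rightarrow> complex \<Rightarrow> plane_map" where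
  "normal_form a0 a1 b0 = (\<lambda>(x, y). (a0 + a1 * x, (b0 + y) / x))"

end

theory Submission
  imports Defs
begin

text \<open>
  Put \<open>X = \<gamma>\<^sub>0 + \<gamma>\<^sub>1 x\<^sub>1 + \<gamma>\<^sub>2 x\<^sub>2\<close>. The condition \<open>\<alpha>\<^sub>1 \<gamma>\<^sub>2 = \<alpha>\<^sub>2 \<gamma>\<^sub>1\<close> and birationality make the first component
  of \<open>f\<close> a function \<open>\<mu> + l X\<close> with \<open>l \<noteq> 0\<close>, and force \<open>\<beta>\<^sub>1 \<gamma>\<^sub>2 \<noteq> \<beta>\<^sub>2 \<gamma>\<^sub>1\<close>
  (\<open>family_map_nondegenerate\<close>).

  If \<open>\<gamma>\<^sub>2 \<noteq> 0\<close>, the values of \<open>X\<close> along an orbit satisfy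
  \<open>X\<^sub>n\<^sub>+\<^sub>1 = a X\<^sub>n + b + (c + d X\<^sub>n\<^sub>-\<^sub>1) / X\<^sub>n\<close> with \<open>d \<noteq> 0\<close>, starting from two independent linear functions. No
  curve is ever contracted onto a point of indeterminacy, so that the denominators of \<open>X\<^sub>n\<close> in lowest
  terms have the generic degrees: they double at each step if \<open>a \<noteq> 0\<close> and grow like Fibonacci numbers if
  \<open>a = 0\<close> (\<open>recurrence_growth\<close>). These degrees are lower bounds for those of the projective iterates, so the entropy is
  positive (\<open>entropy_nonzero\<close>). Zero entropy thus leaves \<open>\<gamma>\<^sub>2 = 0\<close>, where an explicit affine
  change produces the normal form (\<open>conjugate_to_normal_form\<close>).

  The normal form acts on \<open>x\<close> alone by an affine map, so it preserves the fibration \<open>x\<close>. Its inverse is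
  the polynomial map \<open>g(x, y) = (w, w y - b\<^sub>0)\<close> with \<open>w\<close> of degree one in \<open>x\<close>: the factor \<open>w\<close>, which is not a
  constant, twists the fibres. An invariant \<open>U\<close> that depends on \<open>y\<close> with degree \<open>e > 0\<close> would have to absorb this
  twist in a polynomial factor of degree \<open>e\<close> in \<open>x\<close>, and the difference of \<open>U\<close> and its restriction to \<open>y = \<infinity>\<close>
  contradicts that (\<open>invariant_ratio_degree_0\<close>). So \<open>U\<close> is a function of \<open>x\<close> and its fibres are the vertical lines.
\<close>

section \<open>Polynomials as functions\<close>

lemma poly_eq_0_if_infinite_roots:
  fixes p :: "'a::idom poly"
  assumes "infinite S" "\<And>x. x \<in> S \<Longrightarrow> poly p x = 0"
  shows "p = 0"
proof (rule ccontr)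
  assume "p \<noteq> 0"
  then have "finite {x. poly p x = 0}" by (rule poly_roots_finite)
  moreover have "S \<subseteq> {x. poly p x = 0}" using assms(2) by auto
  ultimately show False using assms(1) finite_subset by blast
qed

lemma eval2_0 [simp]: "eval2 0 z = 0"
  and eval2_1 [simp]: "eval2 1 z = 1"
  and eval2_add [simp]: "eval2 (P + Q) z = eval2 P z + eval2 Q z"
  and eval2_diff [simp]: "eval2 (P - Q) z = eval2 P z - eval2 Q z"
  and eval2_mult [simp]: "eval2 (P * Q) z = eval2 P z * eval2 Q z"
  and eval2_power [simp]: "eval2 (P ^ n) z = eval2 P z ^ n"
  and eval2_const2 [simp]: "eval2 (const2 c) z = c"
  and eval2_const_poly [simp]: "eval2 [:p:] z = poly p (fst z)"
  by (simp_all add: eval2_def const2_def)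

text \<open>
  Since \<open>\<complex>\<close> is infinite, polynomials may be compared through their values. Most identities
  below are proved in this way; values cannot, however, be used to cancel a factor, which is why
  polynomials are kept alongside.
\<close>

lemma eval2_cong_imp_eq:
  assumes "\<And>x y. eval2 P (x, y) = eval2 Q (x, y)"
  shows "P = Q"
proof -
  have "poly (P - Q) [:c:] = 0" for c
  proof -
    have "poly (poly P [:c:]) = poly (poly Q [:c:])"
      using assms by (auto simp: eval2_def)
    then show ?thesis by (simp add: poly_eq_poly_eq_iff)
  qed
  moreover have "infinite (range (\<lambda>c::complex. [:c:]))"
    by (auto dest!: finite_imageD simp: inj_def infinite_UNIV_char_0)
  ultimately have "P - Q = 0"
    by (intro poly_eq_0_if_infinite_roots[of "range (\<lambda>c. [:c:])"]) auto
  then show ?thesis by simp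
qed

lemma eval3_0 [simp]: "eval3 0 a b c = 0"
  and eval3_1 [simp]: "eval3 1 a b c = 1"
  and eval3_add [simp]: "eval3 (P + Q) a b c = eval3 P a b c + eval3 Q a b c"
  and eval3_diff [simp]: "eval3 (P - Q) a b c = eval3 P a b c - eval3 Q a b c"
  and eval3_mult [simp]: "eval3 (P * Q) a b c = eval3 P a b c * eval3 Q a b c"
  by (simp_all add: eval3_def)

lemma eval3_cong_imp_eq:
  assumes "\<And>a b c. eval3 P a b c = eval3 Q a b c"
  shows "P = Q"
proof -
  have "poly (P - Q) [:[:c:]:] = 0" for c
  proof -
    have "poly P [:[:c:]:] = poly Q [:[:c:]:]"
      using assms by (intro eval2_cong_imp_eq) (simp add: eval2_def eval3_def)
    then show ?thesis by simp
  qed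
  moreover have "infinite (range (\<lambda>c::complex. [:[:c:]:]))"
    by (auto dest!: finite_imageD simp: inj_def infinite_UNIV_char_0)
  ultimately have "P - Q = 0"
    by (intro poly_eq_0_if_infinite_roots[of "range (\<lambda>c. [:[:c:]:])"]) auto
  then show ?thesis by simp
qed

definition lin3 :: "complex \<Rightarrow> complex \<Rightarrow> complex \<Rightarrow> poly3" where
  "lin3 a b c = [:[:[:0, a:], [:b:]:], [:[:c:]:]:]"

lemma eval3_lin3 [simp]: "eval3 (lin3 p q r) a b c = p * a + q * b + r * c"
  by (simp add: eval3_def lin3_def algebra_simps)

definition lin2 :: "complex \<Rightarrow> complex \<Rightarrow> complex \<Rightarrow> complex poly poly" where
  "lin2 a b c = [:[:a, b:], [:c:]:]"

lemma eval2_lin2 [simp]: "eval2 (lin2 p q r) z = p + q * fst z + r * snd z"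
  by (simp add: eval2_def lin2_def algebra_simps)

text \<open>
  Evaluation and substitution in several variables both replace coefficients by their images and
  then evaluate; this is how a ring homomorphism passes through one such layer.
\<close>

lemma poly_map_poly_hom:
  fixes h :: "'a::comm_ring_1 \<Rightarrow> 'b::comm_ring_1" and g :: "'c::zero \<Rightarrow> 'a"
  assumes "h 0 = 0" "\<And>x y. h (x + y) = h x + h y" "\<And>x y. h (x * y) = h x * h y" "g 0 = 0"
  shows "h (poly (map_poly g P) F) = poly (map_poly (\<lambda>c. h (g c)) P) (h F)"
  using assms by (induction P) (simp_all add: map_poly_pCons)

lemma eval3_altdef:
  "eval3 P a b c = poly (map_poly (\<lambda>q. poly (map_poly (\<lambda>r. poly r a) q) b) P) c"
proof -
  have 1: "poly (poly q [:b:]) a = poly (map_poly (\<lambda>r. poly r a) q) b" for q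
    by (induction q) (simp_all add: map_poly_pCons)
  have "eval3 P a b c = poly (map_poly (\<lambda>q. poly (poly q [:b:]) a) P) c"
    unfolding eval3_def by (induction P) (simp_all add: map_poly_pCons)
  then show ?thesis by (simp add: 1)
qed

lemma eval3_subst3 [simp]:
  "eval3 (subst3 (F0, F1, F2) P) a b c =
   eval3 P (eval3 F0 a b c) (eval3 F1 a b c) (eval3 F2 a b c)"
proof -
  have const: "eval3 [:[:[:k:]:]:] a b c = k" for k by (simp add: eval3_def)
  show ?thesis
    unfolding subst3_def
    by (simp add: poly_map_poly_hom[of "\<lambda>P. eval3 P a b c"] const eval3_altdef[of P] map_poly_idI)
qed

section \<open>Statements that hold off a curve\<close>

text \<open>
  A curve may be replaced by any nonzero polynomial, constants included. Intersections of such
  statements then correspond to products of polynomials.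
\<close>

lemma off_curve_iff: "off_curve R \<longleftrightarrow> (\<exists>P. P \<noteq> 0 \<and> (\<forall>z. eval2 P z \<noteq> 0 \<longrightarrow> R z))"
proof
  assume "off_curve R"
  then obtain P where P: "P \<notin> range const2" "\<forall>z. z \<notin> zero_set P \<longrightarrow> R z"
    by (auto simp: off_curve_def algebraic_curve_def)
  then have "P \<noteq> 0"
    by (metis const2_def pCons_0_0 rangeI)
  then show "\<exists>P. P \<noteq> 0 \<and> (\<forall>z. eval2 P z \<noteq> 0 \<longrightarrow> R z)"
    using P(2) by (auto simp: zero_set_def)
next
  assume "\<exists>P. P \<noteq> 0 \<and> (\<forall>z. eval2 P z \<noteq> 0 \<longrightarrow> R z)"
  then obtain P where P: "P \<noteq> 0" "\<forall>z. eval2 P z \<noteq> 0 \<longrightarrow> R z" by blast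
  \<comment> \<open>a nonzero constant is not the equation of a curve; multiplying by \<open>y\<close> repairs this\<close>
  define Q where "Q = [:0, 1:] * P"
  have "degree Q \<noteq> 0" unfolding Q_def using P(1) by (subst degree_mult_eq) auto
  then have "Q \<notin> range const2" by (auto simp: const2_def)
  then have "algebraic_curve (zero_set Q)" unfolding algebraic_curve_def by blast
  moreover have "R z" if "z \<notin> zero_set Q" for z
    using that P(2) unfolding zero_set_def Q_def mem_Collect_eq eval2_mult by (metis mult_zero_right)
  ultimately show "off_curve R" unfolding off_curve_def by blast
qed

lemma off_curveI: "P \<noteq> 0 \<Longrightarrow> (\<And>z. eval2 P z \<noteq> 0 \<Longrightarrow> R z) \<Longrightarrow> off_curve R"
  by (auto simp: off_curve_iff)

lemma off_curve_all: "(\<And>z. R z) \<Longrightarrow> off_curve R"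
  by (rule off_curveI[of 1]) auto

lemma off_curve_conj:
  assumes "off_curve R" "off_curve S" shows "off_curve (\<lambda>z. R z \<and> S z)"
proof -
  obtain P Q where "P \<noteq> 0" "\<forall>z. eval2 P z \<noteq> 0 \<longrightarrow> R z" "Q \<noteq> 0" "\<forall>z. eval2 Q z \<noteq> 0 \<longrightarrow> S z"
    using assms by (auto simp: off_curve_iff)
  then show ?thesis by (intro off_curveI[of "P * Q"]) auto
qed

lemma off_curve_mono:
  assumes "off_curve R" "\<And>z. R z \<Longrightarrow> S z" shows "off_curve S"
  using assms by (auto simp: off_curve_iff)

lemma off_curve_nonzero: "P \<noteq> 0 \<Longrightarrow> off_curve (\<lambda>z. eval2 P z \<noteq> 0)"
  by (rule off_curveI)

lemma off_curve_False: "\<not> off_curve (\<lambda>z. False)"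
proof
  assume "off_curve (\<lambda>z. False)"
  then obtain P where "P \<noteq> 0" "\<forall>z. eval2 P z = 0" by (auto simp: off_curve_iff)
  then show False using eval2_cong_imp_eq[of P 0] by auto
qed

lemma off_curve_ex: "off_curve R \<Longrightarrow> \<exists>z. R z"
  using off_curve_False off_curve_mono by blast

text \<open>
  The plane is irreducible: the complement of a curve is dense enough to determine a polynomial.
\<close>

lemma off_curve_eq_imp_eq:
  assumes "off_curve (\<lambda>z. eval2 P z = eval2 Q z)" shows "P = Q"
proof (rule ccontr)
  assume "P \<noteq> Q"
  then have "off_curve (\<lambda>z. eval2 (P - Q) z \<noteq> 0)" by (intro off_curve_nonzero) simp
  from off_curve_ex[OF off_curve_conj[OF this assms]] show False by simp
qed

text \<open>
  Substitution of a triangular polynomial map \<open>(x, y) \<mapsto> (w(x), q(x, y))\<close>. Both the translations and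
  the polynomial map inverse to the normal form are of this kind, and the degree in \<open>y\<close> is easy
  to follow.
\<close>

definition skew_subst ::
    "complex poly \<Rightarrow> complex poly poly \<Rightarrow> complex poly poly \<Rightarrow> complex poly poly" where
  "skew_subst w q P = pcompose (map_poly (\<lambda>p. pcompose p w) P) q"

lemma eval2_skew_subst [simp]:
  "eval2 (skew_subst w q P) z = eval2 P (poly w (fst z), eval2 q z)"
proof -
  have "eval2 (skew_subst w q P) z = poly (map_poly (\<lambda>p. poly p (poly w (fst z))) P) (eval2 q z)"
    unfolding skew_subst_def pcompose_altdef[of "map_poly _ _"]
    by (simp add: poly_map_poly_hom[of "\<lambda>P. eval2 P z"] map_poly_map_poly o_def poly_pcompose)
  also have "\<dots> = eval2 P (poly w (fst z), eval2 q z)"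
    unfolding eval2_def by (induction P) (simp_all add: map_poly_pCons)
  finally show ?thesis .
qed

lemma degree_skew_subst:
  assumes "degree w > 0" shows "degree (skew_subst w q P) = degree P * degree q"
  unfolding skew_subst_def using assms
  by (simp add: degree_pcompose degree_map_poly pcompose_eq_0_iff)

lemma skew_subst_eq_0_iff:
  assumes "degree w > 0" "degree q > 0" shows "skew_subst w q P = 0 \<longleftrightarrow> P = 0"
  unfolding skew_subst_def using assms
  by (simp add: pcompose_eq_0_iff map_poly_eq_0_iff)

lemma off_curve_skew:
  assumes "off_curve R" "degree w > 0" "degree q > 0"
  shows "off_curve (\<lambda>z. R (poly w (fst z), eval2 q z))"
proof -
  obtain P where P: "P \<noteq> 0" "\<forall>z. eval2 P z \<noteq> 0 \<longrightarrow> R z"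
    using assms(1) by (auto simp: off_curve_iff)
  then show ?thesis
    using assms by (intro off_curveI[of "skew_subst w q P"]) (auto simp: skew_subst_eq_0_iff)
qed

section \<open>A second order recurrence with exponential degree growth\<close>

text \<open>
  This section studies \<open>X\<^sub>n\<^sub>+\<^sub>1 = a X\<^sub>n + b + (c + d X\<^sub>n\<^sub>-\<^sub>1) / X\<^sub>n\<close> with \<open>d \<noteq> 0\<close>, where \<open>X\<^sub>-\<^sub>1\<close> and \<open>X\<^sub>0\<close> are
  two independent linear polynomials in \<open>x, y\<close>. Fractions are cleared in the compactification in which
  no common factors ever appear: the projective plane if \<open>a \<noteq> 0\<close>, where the state is a triple
  \<open>[Z : U : X]\<close> with \<open>X\<^sub>n\<^sub>-\<^sub>1 = U / Z\<close>, \<open>X\<^sub>n = X / Z\<close>, and a product of two projective lines if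
  \<open>a = 0\<close>, where it is a quadruple with \<open>X\<^sub>n\<^sub>-\<^sub>1 = U / S\<close>, \<open>X\<^sub>n = P / Q\<close>. The degree of the denominator of
  \<open>X\<^sub>n\<close> then obeys an explicit recurrence.
\<close>

lemma const2_0 [simp]: "const2 0 = 0"
  and const2_1 [simp]: "const2 1 = 1"
  and const2_add: "const2 (r + s) = const2 r + const2 s"
  and const2_diff: "const2 (r - s) = const2 r - const2 s"
  and const2_minus: "const2 (- r) = - const2 r"
  and const2_mult: "const2 (r * s) = const2 r * const2 s"
  and const2_eq_0_iff [simp]: "const2 r = 0 \<longleftrightarrow> r = 0"
  by (simp_all add: const2_def one_pCons pCons_0_0)

lemma const2_power: "const2 (r ^ n) = const2 r ^ n"
  by (induction n) (simp_all add: const2_mult)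

lemmas const2_hom = const2_add const2_diff const2_minus const2_mult const2_power

lemma degree_const2 [simp]: "degree (const2 r) = 0"
  by (simp add: const2_def)

lemma is_unit_const2: "r \<noteq> 0 \<Longrightarrow> const2 r dvd 1"
  by (metis const2_1 const2_mult dvd_triv_left right_inverse)

lemma degree_const2_mult [simp]: "degree (const2 r * P) = (if r = 0 then 0 else degree P)"
  by (cases "P = 0") (auto simp: degree_mult_eq)

lemma prime_dvd_const2_mult:
  assumes "prime_elem \<pi>" "r \<noteq> 0" shows "\<pi> dvd const2 r * P \<longleftrightarrow> \<pi> dvd P"
  using assms is_unit_const2[of r] by (metis dvd_mult_unit_iff mult.commute)

lemma coprime_by_primes:
  fixes P Q :: "complex poly poly"
  assumes "P \<noteq> 0 \<or> Q \<noteq> 0" "\<And>\<pi>. prime_elem \<pi> \<Longrightarrow> \<pi> dvd P \<Longrightarrow> \<pi> dvd Q \<Longrightarrow> False"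
  shows "coprime P Q"
proof (rule ccontr)
  assume "\<not> coprime P Q"
  then obtain \<pi> where "\<pi> dvd gcd P Q" "prime \<pi>"
    using assms(1) prime_divisor_exists[of "gcd P Q"] by (auto simp: is_unit_gcd)
  then show False using assms(2)[of \<pi>] by (auto dest: prime_imp_prime_elem)
qed

text \<open>
  The map \<open>(u, x)\<close> contracts no curve to a point: along the curve \<open>\<pi> = 0\<close> the two functions are
  never both constant.
\<close>

definition separating :: "complex poly poly \<Rightarrow> complex poly poly \<Rightarrow> bool" where
  "separating u x \<longleftrightarrow> (\<forall>\<pi> k k'. prime_elem \<pi> \<longrightarrow> \<pi> dvd u - const2 k \<longrightarrow> \<not> \<pi> dvd x - const2 k')"

text \<open>
  Two consecutive terms of the recurrence determine the previous one, because \<open>d \<noteq> 0\<close>. If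
  \<open>X\<^sub>n\<^sub>-\<^sub>1\<close> and \<open>X\<^sub>n\<close> were finite and constant along a curve \<open>\<pi> = 0\<close>, then so would be all earlier
  terms, down to the initial ones. This is the reason why no cancellation occurs.
\<close>

lemma triple_values_not_both_constant:
  fixes a b c d :: complex and Z U X :: "nat \<Rightarrow> complex poly poly"
  assumes d: "d \<noteq> 0" and init: "Z 0 = 1" "separating (U 0) (X 0)"
    and Z: "\<And>n. Z (Suc n) = Z n * X n" and U: "\<And>n. U (Suc n) = X n ^ 2"
    and X: "\<And>n. X (Suc n) = const2 a * X n ^ 2 + const2 b * X n * Z n + const2 c * Z n ^ 2
              + const2 d * U n * Z n"
    and \<pi>: "prime_elem \<pi>"
  shows "\<not> \<pi> dvd Z n \<Longrightarrow> \<pi> dvd U n - const2 k * Z n \<Longrightarrow> \<not> \<pi> dvd X n - const2 k' * Z n"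
proof (induction n arbitrary: k k')
  case 0
  then show ?case using init \<pi> by (auto simp: separating_def)
next
  case (Suc n)
  have nd: "\<not> \<pi> dvd Z n" "\<not> \<pi> dvd X n" using Suc.prems(1) \<pi> by (auto simp: Z)
  have "U (Suc n) - const2 k * Z (Suc n) = X n * (X n - const2 k * Z n)"
    by (simp add: U Z algebra_simps power2_eq_square)
  then have xk: "\<pi> dvd X n - const2 k * Z n"
    using Suc.prems(2) nd \<pi> by (simp add: prime_elem_dvd_mult_iff)
  show ?case
  proof
    assume *: "\<pi> dvd X (Suc n) - const2 k' * Z (Suc n)"
    define m where "m = (a * k ^ 2 + b * k + c - k' * k) / d"
    have m: "d * m = a * k ^ 2 + b * k + c - k' * k" using d by (simp add: m_def)
    have "X (Suc n) - const2 k' * Z (Suc n) =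
        (X n - const2 k * Z n) * (const2 a * (X n + const2 k * Z n) + const2 b * Z n - const2 k' * Z n)
        + const2 d * U n * Z n + const2 (a * k ^ 2 + b * k + c - k' * k) * Z n ^ 2"
      unfolding X Z const2_hom by algebra
    also have "\<dots> =
        (X n - const2 k * Z n) * (const2 a * (X n + const2 k * Z n) + const2 b * Z n - const2 k' * Z n)
        + const2 d * (Z n * (U n - const2 (- m) * Z n))"
      unfolding m[symmetric] const2_hom by algebra
    finally have "\<pi> dvd const2 d * (Z n * (U n - const2 (- m) * Z n))"
      using * xk by (metis dvd_add_right_iff dvd_mult2)
    then have "\<pi> dvd U n - const2 (- m) * Z n"
      using \<pi> d nd by (metis prime_dvd_const2_mult prime_elem_dvd_mult_iff)
    from Suc.IH[OF nd(1) this] xk show False by blast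
  qed
qed

text \<open>
  A common factor of \<open>Z\<^sub>n\<^sub>+\<^sub>1 = Z\<^sub>n X\<^sub>n\<close> and \<open>X\<^sub>n\<^sub>+\<^sub>1\<close> cannot divide \<open>Z\<^sub>n\<close>, where \<open>X\<^sub>n\<^sub>+\<^sub>1\<close> is congruent to
  \<open>a X\<^sub>n\<^sup>2\<close>. If it divides \<open>X\<^sub>n\<close>, then the two coordinates take the constant values
  \<open>- c / d\<close> and \<open>0\<close> along it.
\<close>

lemma triple_coprime:
  fixes a b c d :: complex and Z U X :: "nat \<Rightarrow> complex poly poly"
  assumes d: "d \<noteq> 0" and a: "a \<noteq> 0" and init: "Z 0 = 1" "separating (U 0) (X 0)"
    and Z: "\<And>n. Z (Suc n) = Z n * X n" and U: "\<And>n. U (Suc n) = X n ^ 2"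
    and X: "\<And>n. X (Suc n) = const2 a * X n ^ 2 + const2 b * X n * Z n + const2 c * Z n ^ 2
              + const2 d * U n * Z n"
    and nz: "\<And>n. X n \<noteq> 0"
  shows "coprime (Z n) (X n)"
proof (induction n)
  case 0
  then show ?case using init by simp
next
  case (Suc n)
  show ?case
  proof (rule coprime_by_primes)
    fix \<pi> assume \<pi>: "prime_elem \<pi>" and dvd: "\<pi> dvd Z (Suc n)" "\<pi> dvd X (Suc n)"
    have notboth: "\<not> (\<pi> dvd Z n \<and> \<pi> dvd X n)"
      using Suc \<pi> by (meson coprime_common_divisor prime_elem_not_unit)
    show False
    proof (cases "\<pi> dvd Z n")
      case True
      have "X (Suc n) = const2 a * X n ^ 2 + Z n * (const2 b * X n + const2 c * Z n + const2 d * U n)"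
        unfolding X by algebra
      then have "\<pi> dvd const2 a * X n ^ 2"
        using True dvd(2) by (metis dvd_add_left_iff dvd_mult2)
      then have "\<pi> dvd X n"
        using \<pi> a by (auto simp: prime_dvd_const2_mult dest: prime_elem_dvd_power)
      then show ?thesis using notboth True by blast
    next
      case False
      then have x: "\<pi> dvd X n" using dvd(1) \<pi> by (simp add: Z prime_elem_dvd_mult_iff)
      have "X (Suc n) = X n * (const2 a * X n + const2 b * Z n)
          + const2 d * (Z n * (U n - const2 (- c / d) * Z n))"
      proof -
        have "const2 c = const2 d * const2 (c / d)" using d by (simp flip: const2_mult)
        then show ?thesis unfolding X minus_divide_left[symmetric] const2_minus by algebra
      qed
      then have "\<pi> dvd const2 d * (Z n * (U n - const2 (- c / d) * Z n))"
        using x dvd(2) by (metis dvd_add_right_iff dvd_mult2)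
      then have "\<pi> dvd U n - const2 (- c / d) * Z n"
        using \<pi> d False by (metis prime_dvd_const2_mult prime_elem_dvd_mult_iff)
      from triple_values_not_both_constant[OF d init Z U X \<pi> False this, of 0] x show ?thesis by simp
    qed
  qed (use nz in auto)
qed

text \<open>
  On a generic vertical line \<open>X\<^sub>n\<close> has a simple pole at infinity, so its numerator has one
  degree more than its denominator; the leading term comes from \<open>a X\<^sub>n\<^sup>2\<close> and degrees double.
\<close>

lemma triple_degrees:
  fixes a b c d :: complex and Z U X :: "nat \<Rightarrow> complex poly poly"
  assumes a: "a \<noteq> 0" and init: "Z 0 = 1" "degree (U 0) = 0" "degree (X 0) = 1"
    and Z: "\<And>n. Z (Suc n) = Z n * X n" and U: "\<And>n. U (Suc n) = X n ^ 2"
    and X: "\<And>n. X (Suc n) = const2 a * X n ^ 2 + const2 b * X n * Z n + const2 c * Z n ^ 2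
              + const2 d * U n * Z n"
  shows "Z n \<noteq> 0 \<and> degree (Z n) + 1 = 2 ^ n \<and> degree (X n) = 2 ^ n \<and> degree (U n) \<le> 2 ^ n"
proof (induction n)
  case 0
  then show ?case using init by simp
next
  case (Suc n)
  then have IH: "Z n \<noteq> 0" "degree (Z n) + 1 = 2 ^ n" "degree (X n) = 2 ^ n" "degree (U n) \<le> 2 ^ n"
    by auto
  then have x: "X n \<noteq> 0" by auto
  have top: "degree (const2 a * X n ^ 2) = 2 * 2 ^ n"
    using a IH by (simp add: degree_power_eq x)
  have "degree (const2 b * X n * Z n + const2 c * Z n ^ 2 + const2 d * U n * Z n) < 2 * 2 ^ n"
  proof (intro degree_add_less)
    show "degree (const2 b * X n * Z n) < 2 * 2 ^ n"
      using IH degree_mult_le[of "const2 b * X n" "Z n"] by (simp split: if_splits)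
    show "degree (const2 c * Z n ^ 2) < 2 * 2 ^ n"
      using IH by (simp add: degree_power_eq)
    show "degree (const2 d * U n * Z n) < 2 * 2 ^ n"
      using IH degree_mult_le[of "const2 d * U n" "Z n"] by (simp split: if_splits)
  qed
  then have "degree (X (Suc n)) = 2 * 2 ^ n"
    unfolding X add.assoc using top by (subst degree_add_eq_left) (auto simp: add.assoc)
  moreover have "degree (Z (Suc n)) + 1 = 2 * 2 ^ n" using IH x by (simp add: Z degree_mult_eq)
  moreover have "degree (U (Suc n)) = 2 * 2 ^ n" using IH x by (simp add: U degree_power_eq)
  ultimately show ?case using IH x by (simp add: Z)
qed

lemma quadruple_values_not_both_constant:
  fixes b c d :: complex and U S P Q :: "nat \<Rightarrow> complex poly poly"
  assumes d: "d \<noteq> 0" and init: "S 0 = 1" "Q 0 = 1" "separating (U 0) (P 0)"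
    and U: "\<And>n. U (Suc n) = P n" and S: "\<And>n. S (Suc n) = Q n"
    and P: "\<And>n. P (Suc n) = const2 b * P n * S n + (const2 c * S n + const2 d * U n) * Q n"
    and Q: "\<And>n. Q (Suc n) = S n * P n"
    and \<pi>: "prime_elem \<pi>"
  shows "\<not> \<pi> dvd S n \<Longrightarrow> \<not> \<pi> dvd Q n \<Longrightarrow> \<pi> dvd U n - const2 k * S n \<Longrightarrow>
    \<not> \<pi> dvd P n - const2 k' * Q n"
proof (induction n arbitrary: k k')
  case 0
  then show ?case using init \<pi> by (auto simp: separating_def)
next
  case (Suc n)
  have nd: "\<not> \<pi> dvd S n" "\<not> \<pi> dvd Q n" using Suc.prems \<pi> by (auto simp: S Q)
  have pk: "\<pi> dvd P n - const2 k * Q n" using Suc.prems(3) by (simp add: U S)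
  show ?case
  proof
    assume *: "\<pi> dvd P (Suc n) - const2 k' * Q (Suc n)"
    define m where "m = (b * k + c - k' * k) / d"
    have m: "d * m = b * k + c - k' * k" using d by (simp add: m_def)
    have "P (Suc n) - const2 k' * Q (Suc n) =
        (P n - const2 k * Q n) * ((const2 b - const2 k') * S n)
        + const2 d * U n * Q n + const2 (b * k + c - k' * k) * S n * Q n"
      unfolding P Q const2_hom by algebra
    also have "\<dots> =
        (P n - const2 k * Q n) * ((const2 b - const2 k') * S n)
        + const2 d * (Q n * (U n - const2 (- m) * S n))"
      unfolding m[symmetric] const2_hom by algebra
    finally have "\<pi> dvd const2 d * (Q n * (U n - const2 (- m) * S n))"
      using * pk by (metis dvd_add_right_iff dvd_mult2)
    then have "\<pi> dvd U n - const2 (- m) * S n"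
      using \<pi> d nd by (metis prime_dvd_const2_mult prime_elem_dvd_mult_iff)
    from Suc.IH[OF nd this] pk show False by blast
  qed
qed

text \<open>
  At infinity on a generic vertical line \<open>X\<^sub>n\<close> has a pole at even times \<open>n\<close> and is finite at odd times. This
  determines the leading terms: \<open>Q\<^sub>2\<^sub>k\<^sub>+\<^sub>1 = S\<^sub>2\<^sub>k P\<^sub>2\<^sub>k\<close>, and \<open>P\<^sub>2\<^sub>k\<^sub>+\<^sub>2\<close> has the degree of \<open>P\<^sub>2\<^sub>k Q\<^sub>2\<^sub>k\<^sub>+\<^sub>1\<close>. These
  degrees are Fibonacci-like; it suffices that they double in two steps.
\<close>

lemma quadruple_degrees:
  fixes b c d :: complex and U S P Q :: "nat \<Rightarrow> complex poly poly"
  assumes d: "d \<noteq> 0" and init: "S 0 = 1" "Q 0 = 1" "degree (U 0) = 0" "degree (P 0) = 1"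
    and U: "\<And>n. U (Suc n) = P n" and S: "\<And>n. S (Suc n) = Q n"
    and P: "\<And>n. P (Suc n) = const2 b * P n * S n + (const2 c * S n + const2 d * U n) * Q n"
    and Q: "\<And>n. Q (Suc n) = S n * P n"
  shows "S (2 * k) \<noteq> 0 \<and> degree (U (2 * k)) \<le> degree (S (2 * k)) \<and>
    degree (Q (2 * k)) < degree (P (2 * k)) \<and> 2 ^ k \<le> degree (P (2 * k))"
proof (induction k)
  case 0
  then show ?case using init by simp
next
  case (Suc k)
  define n where "n = 2 * k"
  define u s p q where "u = degree (U n)" "s = degree (S n)" "p = degree (P n)" "q = degree (Q n)"
  note defs = u_s_p_q_def
  have IH: "S n \<noteq> 0" "u \<le> s" "q < p" "2 ^ k \<le> p" using Suc by (auto simp: n_def defs)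
  then have nz: "P n \<noteq> 0" by (auto simp: defs)
  have q1: "degree (Q (Suc n)) = s + p" using IH nz by (simp add: Q degree_mult_eq defs)
  have "degree (const2 b * P n * S n) \<le> s + p"
    using degree_mult_le[of "const2 b * P n" "S n"] by (simp add: defs split: if_splits)
  moreover have "degree (const2 c * S n + const2 d * U n) \<le> s"
    using IH by (intro degree_add_le) (auto simp: defs)
  then have "degree ((const2 c * S n + const2 d * U n) * Q n) \<le> s + p"
    using degree_mult_le[of "const2 c * S n + const2 d * U n" "Q n"] IH by (simp add: defs)
  ultimately have p1: "degree (P (Suc n)) \<le> s + p" unfolding P by (intro degree_add_le)
  have "degree (const2 d * P n + const2 c * Q n) = p"
    using d IH by (subst degree_add_eq_left) (auto simp: defs)
  then have main: "degree ((const2 c * S (Suc n) + const2 d * U (Suc n)) * Q (Suc n)) = p + (s + p)"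
    using q1 IH nz by (subst degree_mult_eq) (auto simp: U S Q add.commute)
  have "degree (const2 b * P (Suc n) * S (Suc n)) \<le> (s + p) + q"
    using degree_mult_le[of "const2 b * P (Suc n)" "S (Suc n)"] p1 by (simp add: S defs split: if_splits)
  then have "degree (P (Suc (Suc n))) = p + (s + p)"
    unfolding P[of "Suc n"] using main IH by (subst degree_add_eq_right) auto
  moreover have "degree (Q (Suc (Suc n))) \<le> q + (s + p)"
    using degree_mult_le[of "S (Suc n)" "P (Suc n)"] p1 by (simp add: Q[of "Suc n"]) (simp add: S defs)
  moreover have "degree (U (Suc (Suc n))) \<le> degree (S (Suc (Suc n)))"
    using p1 q1 by (simp add: U S)
  moreover have "S (Suc (Suc n)) \<noteq> 0" using IH nz by (simp add: S Q)
  ultimately show ?case using IH by (simp add: n_def)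
qed

text \<open>
  Besides the pair \<open>P, Q\<close> itself one has to know that \<open>X\<^sub>n\<^sub>-\<^sub>1\<close> and \<open>X\<^sub>n\<close> are never infinite together
  along a curve, that is, that \<open>Q\<close> and \<open>S\<close> are coprime.
\<close>

lemma quadruple_coprime:
  fixes b c d :: complex and U S P Q :: "nat \<Rightarrow> complex poly poly"
  assumes d: "d \<noteq> 0" and init: "S 0 = 1" "Q 0 = 1" "separating (U 0) (P 0)"
      "degree (U 0) = 0" "degree (P 0) = 1"
    and U: "\<And>n. U (Suc n) = P n" and S: "\<And>n. S (Suc n) = Q n"
    and P: "\<And>n. P (Suc n) = const2 b * P n * S n + (const2 c * S n + const2 d * U n) * Q n"
    and Q: "\<And>n. Q (Suc n) = S n * P n"
  shows "coprime (P n) (Q n) \<and> coprime (Q n) (S n) \<and> coprime (U n) (S n) \<and>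
    P n \<noteq> 0 \<and> Q n \<noteq> 0 \<and> S n \<noteq> 0"
proof (induction n)
  case 0
  then show ?case using init by auto
next
  case (Suc n)
  note degs = quadruple_degrees[OF d init(1,2,4,5) U S P Q]
  have IH: "coprime (P n) (Q n)" "coprime (Q n) (S n)" "coprime (U n) (S n)"
    "P n \<noteq> 0" "Q n \<noteq> 0" "S n \<noteq> 0" using Suc by auto
  have notboth: "\<not> (\<pi> dvd A \<and> \<pi> dvd B)" if "prime_elem \<pi>" "coprime A B" for \<pi> A B :: "complex poly poly"
    using that by (meson coprime_common_divisor prime_elem_not_unit)
  have cop: "coprime (P (Suc n)) (Q (Suc n))"
  proof (rule coprime_by_primes)
    fix \<pi> assume \<pi>: "prime_elem \<pi>" and dvd: "\<pi> dvd P (Suc n)" "\<pi> dvd Q (Suc n)"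
    have P': "P (Suc n) = P n * (const2 b * S n) + Q n * (const2 c * S n + const2 d * U n)"
      unfolding P by algebra
    have P'': "P (Suc n) = S n * (const2 b * P n + const2 c * Q n) + const2 d * (Q n * U n)"
      unfolding P by algebra
    show False
    proof (cases "\<pi> dvd S n")
      case True
      then have "\<pi> dvd const2 d * (Q n * U n)" using dvd(1) P'' by (metis dvd_add_right_iff dvd_mult2)
      then have "\<pi> dvd Q n \<or> \<pi> dvd U n"
        using \<pi> d by (metis prime_dvd_const2_mult prime_elem_dvd_mult_iff)
      then show False using True notboth[OF \<pi> IH(2)] notboth[OF \<pi> IH(3)] by blast
    next
      case False
      then have p: "\<pi> dvd P n" using dvd(2) \<pi> by (simp add: Q prime_elem_dvd_mult_iff)
      then have q: "\<not> \<pi> dvd Q n" using notboth[OF \<pi> IH(1)] by blast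
      have "\<pi> dvd Q n * (const2 c * S n + const2 d * U n)"
        using dvd(1) p P' by (metis dvd_add_right_iff dvd_mult2)
      then have "\<pi> dvd const2 c * S n + const2 d * U n"
        using q \<pi> by (simp add: prime_elem_dvd_mult_iff)
      also have "const2 c * S n + const2 d * U n = const2 d * (U n - const2 (- c / d) * S n)"
      proof -
        have "const2 c = const2 d * const2 (c / d)" using d by (simp flip: const2_mult)
        then show ?thesis unfolding minus_divide_left[symmetric] const2_minus by algebra
      qed
      finally have "\<pi> dvd U n - const2 (- c / d) * S n" using \<pi> d by (metis prime_dvd_const2_mult)
      from quadruple_values_not_both_constant[OF d init(1-3) U S P Q \<pi> False q this, of 0] p
      show False by simp
    qed
  qed (use IH in \<open>simp add: Q\<close>)
  moreover have "P (Suc n) \<noteq> 0"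
  proof (cases "even n")
    case True
    then obtain k where k: "n = 2 * k" by blast
    have "degree (Q (Suc n)) > 0" using degs[of k] IH by (auto simp: Q degree_mult_eq k)
    then have "\<not> is_unit (Q (Suc n))" by (auto simp: is_unit_poly_iff)
    then show ?thesis using cop by auto
  next
    case False
    then obtain k where "n = 2 * k + 1" by (rule oddE)
    then have "degree (P (Suc n)) > 0" using degs[of "Suc k"] by auto
    then show ?thesis by auto
  qed
  ultimately show ?case using IH by (auto simp: U S Q coprime_commute)
qed

text \<open>
  The form in which the recurrence arises from iterating a projective map: \<open>X\<^sub>n = x\<^sub>n / z\<^sub>n\<close> with an
  unknown common factor in \<open>z\<^sub>n, u\<^sub>n, x\<^sub>n\<close>. The coprime fraction \<open>P / Q\<close> shows that this factor cannot
  make the degree of the fraction small.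
\<close>

lemma recurrence_growth:
  fixes a b c d :: complex and z u x :: "nat \<Rightarrow> complex poly poly"
  assumes d: "d \<noteq> 0" and z0: "z 0 = 1" and sep: "separating (u 0) (x 0)"
    and deg: "degree (u 0) = 0" "degree (x 0) = 1"
    and nz: "\<And>n. z n \<noteq> 0"
    and u: "\<And>n. u (Suc n) * z n = z (Suc n) * x n"
    and x: "\<And>n. x (Suc n) * x n * z n = z (Suc n) *
      (const2 a * x n ^ 2 + const2 b * x n * z n + const2 c * z n ^ 2 + const2 d * u n * z n)"
  shows "\<exists>P Q. coprime P Q \<and> 2 ^ k \<le> degree Q \<and> x (2 * k + 1) * Q = z (2 * k + 1) * P"
proof (cases "a = 0")
  case False
  define T where "T n = ((\<lambda>(Z, U, X). (Z * X, X ^ 2, const2 a * X ^ 2 + const2 b * X * Z +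
    const2 c * Z ^ 2 + const2 d * U * Z)) ^^ n) (1, u 0, x 0)" for n
  define Z where "Z n = fst (T n)" for n
  define U where "U n = fst (snd (T n))" for n
  define X where "X n = snd (snd (T n))" for n
  note defs = Z_def U_def X_def T_def
  have Z: "Z (Suc n) = Z n * X n" and U: "U (Suc n) = X n ^ 2"
    and X: "X (Suc n) = const2 a * X n ^ 2 + const2 b * X n * Z n + const2 c * Z n ^ 2
              + const2 d * U n * Z n" for n
    by (simp_all add: defs split_beta)
  have init: "Z 0 = 1" "U 0 = u 0" "X 0 = x 0" by (simp_all add: defs)
  have degs: "Z n \<noteq> 0 \<and> degree (Z n) + 1 = 2 ^ n \<and> degree (X n) = 2 ^ n \<and> degree (U n) \<le> 2 ^ n" for n
    by (rule triple_degrees[where a = a and b = b and c = c and d = d, OF False])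
      (use init deg Z U X in auto)
  then have Xnz: "X n \<noteq> 0" for n by (metis degree_0 power_eq_0_iff zero_neq_numeral)
  have cop: "coprime (Z n) (X n)" for n
    by (rule triple_coprime[where U = U and a = a and b = b and c = c and d = d, OF d False])
      (use init sep Z U X Xnz in auto)
  have rel: "Z n * u n = z n * U n \<and> Z n * x n = z n * X n" for n
  proof (induction n)
    case 0
    then show ?case using init z0 by simp
  next
    case (Suc n)
    then have IH: "Z n * u n = z n * U n" "Z n * x n = z n * X n" by auto
    have "z n * (Z (Suc n) * u (Suc n)) = X n * Z n * (u (Suc n) * z n)"
      by (simp add: Z algebra_simps)
    also have "\<dots> = z n * (z (Suc n) * U (Suc n))"
      unfolding u U using IH(2) by algebra
    finally have 1: "Z (Suc n) * u (Suc n) = z (Suc n) * U (Suc n)" using nz by simp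
    have "z n ^ 2 * X n * (Z (Suc n) * x (Suc n)) = Z n * X n * (Z n * (x (Suc n) * x n * z n))"
      unfolding Z using IH(2) by algebra
    also have "\<dots> = z n ^ 2 * X n * (z (Suc n) * X (Suc n))"
      unfolding x X using IH by algebra
    finally have "Z (Suc n) * x (Suc n) = z (Suc n) * X (Suc n)" using nz Xnz by simp
    with 1 show ?case by blast
  qed
  have "(2::nat) ^ k \<le> 2 ^ (2 * k)" "(1::nat) \<le> 2 ^ (2 * k)"
    by (auto intro: power_increasing)
  moreover have "(2::nat) ^ (2 * k + 1) = 2 ^ (2 * k) + 2 ^ (2 * k)" by simp
  ultimately have "2 ^ k \<le> degree (Z (2 * k + 1))" using degs[of "2 * k + 1"] by linarith
  then show ?thesis
    using cop[of "2 * k + 1"] rel[of "2 * k + 1"]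
    by (intro exI[of _ "X (2 * k + 1)"] exI[of _ "Z (2 * k + 1)"]) (simp add: coprime_commute mult.commute)
next
  case True
  define T where "T n = ((\<lambda>(U, S, P, Q). (P, Q, const2 b * P * S + (const2 c * S + const2 d * U) * Q,
    S * P)) ^^ n) (u 0, 1, x 0, 1)" for n
  define U where "U n = fst (T n)" for n
  define S where "S n = fst (snd (T n))" for n
  define P where "P n = fst (snd (snd (T n)))" for n
  define Q where "Q n = snd (snd (snd (T n)))" for n
  note defs = U_def S_def P_def Q_def T_def
  have U: "U (Suc n) = P n" and S: "S (Suc n) = Q n"
    and P: "P (Suc n) = const2 b * P n * S n + (const2 c * S n + const2 d * U n) * Q n"
    and Q: "Q (Suc n) = S n * P n" for n
    by (simp_all add: defs split_beta)
  have init: "U 0 = u 0" "S 0 = 1" "P 0 = x 0" "Q 0 = 1" by (simp_all add: defs)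
  have degs: "S (2 * k) \<noteq> 0 \<and> degree (U (2 * k)) \<le> degree (S (2 * k)) \<and>
    degree (Q (2 * k)) < degree (P (2 * k)) \<and> 2 ^ k \<le> degree (P (2 * k))"
    by (rule quadruple_degrees[where b = b and c = c and d = d, OF d])
      (use init deg U S P Q in auto)
  have cop: "coprime (P n) (Q n) \<and> coprime (Q n) (S n) \<and> coprime (U n) (S n) \<and>
    P n \<noteq> 0 \<and> Q n \<noteq> 0 \<and> S n \<noteq> 0" for n
    by (rule quadruple_coprime[where b = b and c = c and d = d, OF d])
      (use init deg sep U S P Q in auto)
  have rel: "S n * u n = z n * U n \<and> Q n * x n = z n * P n" for n
  proof (induction n)
    case 0
    then show ?case using init z0 by simp
  next
    case (Suc n)
    then have IH: "S n * u n = z n * U n" "Q n * x n = z n * P n" by auto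
    have "z n * (S (Suc n) * u (Suc n)) = Q n * (u (Suc n) * z n)"
      by (simp add: S algebra_simps)
    also have "\<dots> = z n * (z (Suc n) * U (Suc n))"
      unfolding u U using IH(2) by algebra
    finally have 1: "S (Suc n) * u (Suc n) = z (Suc n) * U (Suc n)" using nz by simp
    have "z n ^ 2 * (Q (Suc n) * x (Suc n)) = Q n * S n * (x (Suc n) * x n * z n)"
      unfolding Q using IH(2) by algebra
    also have "\<dots> = z n ^ 2 * (z (Suc n) * P (Suc n))"
      unfolding x P True const2_0 using IH by algebra
    finally have "Q (Suc n) * x (Suc n) = z (Suc n) * P (Suc n)" using nz by simp
    with 1 show ?case by blast
  qed
  have "degree (P (2 * k)) \<le> degree (Q (2 * k + 1))"
    using cop[of "2 * k"] by (simp add: Q degree_mult_eq)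
  then have "2 ^ k \<le> degree (Q (2 * k + 1))" using degs by linarith
  then show ?thesis
    using cop[of "2 * k + 1"] rel[of "2 * k + 1"]
    by (intro exI[of _ "P (2 * k + 1)"] exI[of _ "Q (2 * k + 1)"]) (simp add: mult.commute)
qed

section \<open>Degrees of iterates in the projective plane\<close>

text \<open>
  Homogeneity as a property of values; unlike the condition on coefficients, it is obviously
  stable under substitution.
\<close>

definition homog_fun :: "nat \<Rightarrow> poly3 \<Rightarrow> bool" where
  "homog_fun d P \<longleftrightarrow> (\<forall>t a b c. eval3 P (t * a) (t * b) (t * c) = t ^ d * eval3 P a b c)"

lemma eval3_sum:
  "eval3 P a b c = (\<Sum>k\<le>degree P. \<Sum>j\<le>degree (coeff P k). \<Sum>i\<le>degree (coeff (coeff P k) j).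
     coeff3 P i j k * a ^ i * b ^ j * c ^ k)"
proof -
  have 1: "poly (poly q [:b:]) a = (\<Sum>j\<le>degree q. poly (coeff q j) a * b ^ j)" for q
    by (simp add: poly_altdef[of q "[:b:]"] poly_sum)
  have "eval3 P a b c = (\<Sum>k\<le>degree P. poly (poly (coeff P k) [:b:]) a * c ^ k)"
    by (simp add: eval3_def poly_altdef[of P "[:[:c:]:]"] poly_sum)
  also have "\<dots> = (\<Sum>k\<le>degree P. (\<Sum>j\<le>degree (coeff P k).
      (\<Sum>i\<le>degree (coeff (coeff P k) j). coeff (coeff (coeff P k) j) i * a ^ i) * b ^ j) * c ^ k)"
    by (simp add: 1 poly_altdef[of "coeff _ _" a])
  finally show ?thesis by (simp add: coeff3_def sum_distrib_right)
qed

lemma homogeneous_imp_homog_fun: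
  assumes "homogeneous d P" shows "homog_fun d P"
proof -
  have "coeff3 P i j k * (t * a) ^ i * (t * b) ^ j * (t * c) ^ k =
      t ^ d * (coeff3 P i j k * a ^ i * b ^ j * c ^ k)" for i j k t a b c
  proof (cases "coeff3 P i j k = 0")
    case False
    then have "d = i + j + k" using assms by (auto simp: homogeneous_def)
    then show ?thesis by (simp add: power_add power_mult_distrib)
  qed simp
  then show ?thesis unfolding homog_fun_def eval3_sum sum_distrib_left by (simp only: simp_thms)
qed

definition dehom :: "poly3 \<Rightarrow> complex poly poly" where
  "dehom P = map_poly (map_poly (\<lambda>r. poly r 1)) P"

lemma eval2_dehom [simp]: "eval2 (dehom P) (b, c) = eval3 P 1 b c"
proof -
  have "map_poly (\<lambda>r. poly r 1) 0 = 0" by simp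
  then have "eval2 (dehom P) (b, c) = poly (map_poly (\<lambda>q. poly (map_poly (\<lambda>r. poly r 1) q) b) P) c"
    unfolding eval2_def dehom_def
    by (induction P) (simp_all add: map_poly_pCons)
  then show ?thesis by (simp add: eval3_altdef)
qed

lemma dehom_mult: "dehom (P * Q) = dehom P * dehom Q"
  by (rule eval2_cong_imp_eq) simp

text \<open>
  Homogeneity propagates a zero from the affine chart \<open>x\<^sub>0 = 1\<close> to \<open>x\<^sub>0 \<noteq> 0\<close>, and cancelling \<open>x\<^sub>0\<close> takes
  care of the line at infinity.
\<close>

lemma dehom_eq_0_imp_eq_0:
  assumes "homog_fun d H" "dehom H = 0" shows "H = 0"
proof -
  have "a * eval3 H a b c = 0" for a b c
  proof (cases "a = 0")
    case False
    have "eval3 H (a * 1) (a * (b / a)) (a * (c / a)) = a ^ d * eval3 H 1 (b / a) (c / a)"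
      using assms(1) unfolding homog_fun_def by blast
    also have "eval3 H 1 (b / a) (c / a) = 0"
      using assms(2) by (metis eval2_0 eval2_dehom)
    finally show ?thesis using False by simp
  qed simp
  then have "lin3 1 0 0 * H = 0" by (intro eval3_cong_imp_eq) simp
  moreover have "lin3 1 0 0 \<noteq> 0" by (simp add: lin3_def)
  ultimately show ?thesis by simp
qed

lemma degree_dehom_le: "degree (dehom P) \<le> degree P"
  unfolding dehom_def by (rule degree_le) (auto simp: coeff_map_poly coeff_eq_0)

lemma degree_le_total_degree: "degree P \<le> total_degree P"
proof (cases "P = 0")
  case False
  let ?A = "{i + j + k | i j k. coeff3 P i j k \<noteq> 0}"
  have "?A \<subseteq> (\<Union>k\<le>degree P. \<Union>j\<le>degree (coeff P k). (\<lambda>i. i + j + k) ` {..degree (coeff (coeff P k) j)})"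
  proof
    fix m assume "m \<in> ?A"
    then obtain i j k where m: "m = i + j + k" "coeff (coeff (coeff P k) j) i \<noteq> 0"
      by (auto simp: coeff3_def)
    then have "i \<le> degree (coeff (coeff P k) j)" "coeff (coeff P k) j \<noteq> 0"
      by (auto intro: le_degree)
    moreover from this(2) have "j \<le> degree (coeff P k)" "coeff P k \<noteq> 0" by (auto intro: le_degree)
    moreover from this(2) have "k \<le> degree P" by (rule le_degree)
    ultimately show "m \<in> (\<Union>k\<le>degree P. \<Union>j\<le>degree (coeff P k).
        (\<lambda>i. i + j + k) ` {..degree (coeff (coeff P k) j)})"
      using m(1) by blast
  qed
  then have fin: "finite (insert 0 ?A)" by (rule finite_insert[THEN iffD2, OF finite_subset]) auto
  define k where "k = degree P"
  define j where "j = degree (coeff P k)"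
  define i where "i = degree (coeff (coeff P k) j)"
  have "coeff3 P i j k \<noteq> 0" using False by (simp add: coeff3_def i_def j_def k_def)
  then have "i + j + k \<in> insert 0 ?A" by blast
  then have "i + j + k \<le> Max (insert 0 ?A)" using fin by (rule Max_ge[rotated])
  then show ?thesis unfolding total_degree_def k_def by linarith
qed simp

definition proj_eval :: "proj_map \<Rightarrow> complex \<times> complex \<times> complex \<Rightarrow> complex \<times> complex \<times> complex" where
  "proj_eval = (\<lambda>(F0, F1, F2) (a, b, c). (eval3 F0 a b c, eval3 F1 a b c, eval3 F2 a b c))"

lemma proj_eval_comp: "proj_eval (proj_comp G F) v = proj_eval G (proj_eval F v)"
  by (cases F; cases G; cases v) (simp add: proj_eval_def proj_comp_def)

lemma proj_eval_cong_imp_eq: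
  assumes "\<And>v. proj_eval F v = proj_eval G v" shows "F = G"
  using assms by (cases F; cases G) (auto simp: proj_eval_def intro!: eval3_cong_imp_eq)

lemma proj_eval_iterate: "proj_eval (proj_iterate F n) v = (proj_eval F ^^ n) v"
proof (induction n)
  case 0
  then show ?case by (cases v) (simp add: proj_iterate_def proj_id_def proj_eval_def eval3_def)
next
  case (Suc n)
  have "proj_iterate F (Suc n) = proj_comp F (proj_iterate F n)" by (simp add: proj_iterate_def)
  then show ?case using Suc by (simp add: proj_eval_comp)
qed

text \<open>
  The iterates are built by composing with \<open>F\<close> on the left, which gives their recurrence; composing
  on the right is what shows that they do not vanish.
\<close>

lemma proj_iterate_Suc_right: "proj_iterate F (Suc n) = proj_comp (proj_iterate F n) F"
  by (rule proj_eval_cong_imp_eq) (simp add: proj_eval_iterate proj_eval_comp funpow_swap1)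

lemma homog_fun_subst3:
  assumes "homog_fun m H" "homog_fun d F0" "homog_fun d F1" "homog_fun d F2"
  shows "homog_fun (d * m) (subst3 (F0, F1, F2) H)"
  using assms unfolding homog_fun_def by (simp add: power_mult)

text \<open>
  A common factor of a polynomial in \<open>x\<close> and of one whose leading coefficient in \<open>y\<close> is a
  constant has degree \<open>0\<close> in \<open>y\<close> and divides that constant.
\<close>

lemma separating_linear:
  assumes "q \<noteq> 0" "t \<noteq> 0" shows "separating (lin2 p q 0) (lin2 r s t)"
  unfolding separating_def
proof (intro allI impI notI)
  fix \<pi> k k'
  assume \<pi>: "prime_elem \<pi>" "\<pi> dvd lin2 p q 0 - const2 k" "\<pi> dvd lin2 r s t - const2 k'"
  have "lin2 p q 0 - const2 k \<noteq> 0" "degree (lin2 p q 0 - const2 k) = 0"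
    using assms by (auto simp: lin2_def const2_def)
  then have "degree \<pi> = 0" using dvd_imp_degree_le[OF \<pi>(2)] by simp
  then obtain w where w: "\<pi> = [:w:]" by (rule degree_eq_zeroE)
  have "w dvd coeff (lin2 r s t - const2 k') 1"
    using \<pi>(3) unfolding w const_poly_dvd_iff by blast
  then have "w dvd [:t:]" by (simp add: lin2_def const2_def)
  moreover have "[:t:] dvd 1" using assms(2) by (simp add: is_unit_const_poly_iff dvd_field_iff)
  ultimately have "w dvd 1" by (rule dvd_trans)
  then show False using \<pi>(1) by (simp add: w prime_elem_def is_unit_const_poly_iff)
qed

text \<open>
  A fraction in lowest terms that is expressed through the components \<open>G\<^sub>i\<close> bounds their degree from
  below, even after their common factor is removed: the fraction does not see that factor.
\<close>

lemma degree_le_proj_degree: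
  assumes z: "dehom G0 \<noteq> 0" and cop: "coprime P Q"
    and eq: "(const2 r * dehom G0 + const2 s * dehom G1 + const2 t * dehom G2) * Q = dehom G0 * P"
  shows "degree Q \<le> proj_degree (G0, G1, G2)"
proof -
  define h where "h = gcd G0 (gcd G1 G2)"
  define k0 k1 k2 where "k0 = G0 div h" "k1 = G1 div h" "k2 = G2 div h"
  note k_defs = k0_k1_k2_def
  have "h dvd G0" "h dvd G1" "h dvd G2" unfolding h_def by (auto intro: dvd_trans)
  then have G: "G0 = h * k0" "G1 = h * k1" "G2 = h * k2" by (auto simp: k_defs)
  have nz: "dehom h \<noteq> 0" "dehom k0 \<noteq> 0" using z by (auto simp: G dehom_mult)
  have "dehom h * ((const2 r * dehom k0 + const2 s * dehom k1 + const2 t * dehom k2) * Q) =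
      dehom h * (dehom k0 * P)"
    using eq unfolding G dehom_mult by algebra
  then have "(const2 r * dehom k0 + const2 s * dehom k1 + const2 t * dehom k2) * Q = dehom k0 * P"
    using nz by simp
  then have "Q dvd dehom k0 * P" by (metis dvd_triv_right)
  then have "Q dvd dehom k0" using cop by (simp add: coprime_dvd_mult_left_iff coprime_commute)
  then have "degree Q \<le> degree (dehom k0)" using nz dvd_imp_degree_le by blast
  also have "\<dots> \<le> total_degree k0"
    using degree_dehom_le degree_le_total_degree order_trans by blast
  also have "\<dots> \<le> proj_degree (G0, G1, G2)"
    unfolding proj_degree_def Let_def prod.case h_def[symmetric] k_defs[symmetric] by simp
  finally show ?thesis .
qed

section \<open>Positive entropy when the denominator involves the second coordinate\<close>

text \<open>
  A composite of projective maps could a priori be the zero triple. This does not happen, because \<open>f\<close> is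
  dominant: with \<open>X = \<gamma>\<^sub>0 + \<gamma>\<^sub>1 x\<^sub>1 + \<gamma>\<^sub>2 x\<^sub>2\<close> and \<open>\<mu> = \<alpha>\<^sub>0 - l \<gamma>\<^sub>0\<close> its first component is \<open>\<mu> + l X\<close>, and a
  point \<open>(s, t)\<close> with \<open>s \<noteq> \<mu>\<close> has a preimage, found by solving two linear equations. The
  given \<open>F\<close> may contain a common factor and is therefore compared with the explicit extension
  \<open>[E\<^sub>0 : E\<^sub>1 : E\<^sub>2]\<close>.
\<close>

lemma dominant_pullback_nonzero:
  fixes \<alpha> \<beta> \<gamma> :: "nat \<Rightarrow> complex"
  assumes F0: "F0 \<noteq> 0"
    and F1: "F1 * lin3 1 0 0 = F0 * lin3 (\<alpha> 0) (\<alpha> 1) (\<alpha> 2)"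
    and F2: "F2 * lin3 (\<gamma> 0) (\<gamma> 1) (\<gamma> 2) = F0 * lin3 (\<beta> 0) (\<beta> 1) (\<beta> 2)"
    and l: "l \<noteq> 0" "\<alpha> 1 = l * \<gamma> 1" "\<alpha> 2 = l * \<gamma> 2"
    and det: "\<beta> 1 * \<gamma> 2 - \<beta> 2 * \<gamma> 1 \<noteq> 0"
    and H: "homog_fun m H" "H \<noteq> 0"
  shows "subst3 (F0, F1, F2) H \<noteq> 0"
proof
  assume zero: "subst3 (F0, F1, F2) H = 0"
  define E0 where "E0 = lin3 1 0 0 * lin3 (\<gamma> 0) (\<gamma> 1) (\<gamma> 2)"
  define E1 where "E1 = lin3 (\<alpha> 0) (\<alpha> 1) (\<alpha> 2) * lin3 (\<gamma> 0) (\<gamma> 1) (\<gamma> 2)"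
  define E2 where "E2 = lin3 (\<beta> 0) (\<beta> 1) (\<beta> 2) * lin3 1 0 0"
  have FE: "F0 * E1 = E0 * F1" "F0 * E2 = E0 * F2"
    unfolding E0_def E1_def E2_def using F1 F2 by algebra+
  have "F0 * subst3 (E0, E1, E2) H = 0"
  proof (rule eval3_cong_imp_eq)
    fix a b c
    let ?e = "\<lambda>P. eval3 P a b c"
    have "?e F0 * ?e E1 = ?e E0 * ?e F1" "?e F0 * ?e E2 = ?e E0 * ?e F2"
      using FE by (metis eval3_mult)+
    then have "?e F0 ^ m * eval3 H (?e E0) (?e E1) (?e E2) = ?e E0 ^ m * eval3 H (?e F0) (?e F1) (?e F2)"
      using H(1) unfolding homog_fun_def by (metis mult.commute)
    also have "eval3 H (?e F0) (?e F1) (?e F2) = 0"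
      using zero by (metis eval3_0 eval3_subst3)
    finally show "?e (F0 * subst3 (E0, E1, E2) H) = ?e 0" by auto
  qed
  then have E: "subst3 (E0, E1, E2) H = 0" using F0 by simp
  define \<mu> where "\<mu> = \<alpha> 0 - l * \<gamma> 0"
  have "(s - \<mu>) * eval3 H 1 s t = 0" for s t
  proof (cases "s = \<mu>")
    case False
    define X where "X = (s - \<mu>) / l"
    have X: "X \<noteq> 0" "l * X = s - \<mu>" using False l by (auto simp: X_def)
    define k where "k = \<beta> 1 * \<gamma> 2 - \<beta> 2 * \<gamma> 1"
    define b where "b = (\<gamma> 2 * (t * X - \<beta> 0) - \<beta> 2 * (X - \<gamma> 0)) / k"
    define c where "c = (\<beta> 1 * (X - \<gamma> 0) - \<gamma> 1 * (t * X - \<beta> 0)) / k"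
    have k: "k \<noteq> 0" using det by (simp add: k_def)
    have b: "k * b = \<gamma> 2 * (t * X - \<beta> 0) - \<beta> 2 * (X - \<gamma> 0)"
      and c: "k * c = \<beta> 1 * (X - \<gamma> 0) - \<gamma> 1 * (t * X - \<beta> 0)" using k by (auto simp: b_def c_def)
    have "k * (\<gamma> 0 + \<gamma> 1 * b + \<gamma> 2 * c) = k * X"
      using b c unfolding k_def by algebra
    then have x: "\<gamma> 0 + \<gamma> 1 * b + \<gamma> 2 * c = X" using k by simp
    have "k * (\<beta> 0 + \<beta> 1 * b + \<beta> 2 * c) = k * (t * X)"
      using b c unfolding k_def by algebra
    then have y: "\<beta> 0 + \<beta> 1 * b + \<beta> 2 * c = t * X" using k by simp
    have "\<alpha> 0 + \<alpha> 1 * b + \<alpha> 2 * c = \<mu> + l * (\<gamma> 0 + \<gamma> 1 * b + \<gamma> 2 * c)"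
      unfolding l(2,3) \<mu>_def by (simp add: algebra_simps)
    then have z: "\<alpha> 0 + \<alpha> 1 * b + \<alpha> 2 * c = s" by (simp only: x X(2)) simp
    have "eval3 H X (s * X) (t * X) = eval3 (subst3 (E0, E1, E2) H) 1 b c"
      using x y z by (simp add: E0_def E1_def E2_def)
    also have "\<dots> = 0" by (simp add: E)
    finally have "X ^ m * eval3 H 1 s t = 0"
      using H(1) unfolding homog_fun_def by (metis mult.commute mult.left_neutral)
    then show ?thesis using X by simp
  qed simp
  then have "lin2 (- \<mu>) 1 0 * dehom H = 0"
    by (intro eval2_cong_imp_eq) (simp add: algebra_simps)
  moreover have "lin2 (- \<mu>) 1 0 \<noteq> 0" by (simp add: lin2_def)
  ultimately have "dehom H = 0" by simp
  then show False using H dehom_eq_0_imp_eq_0 by blast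
qed

text \<open>
  Put \<open>u = (x\<^sub>1 - \<mu>) / l\<close>. Then \<open>f\<close> sends \<open>u\<close> to \<open>X\<close> and \<open>X\<close> to \<open>a X + b + (c + d u) / X\<close>, where \<open>d\<close> is
  a nonzero multiple of \<open>\<beta>\<^sub>1 \<gamma>\<^sub>2 - \<beta>\<^sub>2 \<gamma>\<^sub>1\<close>. So the iterates follow the recurrence of the previous sections.
\<close>

lemma iterate_degree_growth:
  fixes \<alpha> \<beta> \<gamma> :: "nat \<Rightarrow> complex"
  assumes F0: "F0 \<noteq> 0"
    and F1: "F1 * lin3 1 0 0 = F0 * lin3 (\<alpha> 0) (\<alpha> 1) (\<alpha> 2)"
    and F2: "F2 * lin3 (\<gamma> 0) (\<gamma> 1) (\<gamma> 2) = F0 * lin3 (\<beta> 0) (\<beta> 1) (\<beta> 2)"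
    and hom: "homog_fun e F0" "homog_fun e F1" "homog_fun e F2"
    and l: "l \<noteq> 0" "\<alpha> 1 = l * \<gamma> 1" "\<alpha> 2 = l * \<gamma> 2"
    and \<gamma>2: "\<gamma> 2 \<noteq> 0"
    and det: "\<beta> 1 * \<gamma> 2 - \<beta> 2 * \<gamma> 1 \<noteq> 0"
  shows "2 ^ k \<le> proj_degree (proj_iterate (F0, F1, F2) (2 * k + 1))"
proof -
  let ?F = "(F0, F1, F2)"
  define G0 where "G0 n = fst (proj_iterate ?F n)" for n
  define G1 where "G1 n = fst (snd (proj_iterate ?F n))" for n
  define G2 where "G2 n = snd (snd (proj_iterate ?F n))" for n
  have G: "proj_iterate ?F n = (G0 n, G1 n, G2 n)" for n by (simp add: G0_def G1_def G2_def)
  have G_0: "G0 0 = lin3 1 0 0" "G1 0 = lin3 0 1 0" "G2 0 = lin3 0 0 1"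
    by (simp_all add: G0_def G1_def G2_def proj_iterate_def proj_id_def lin3_def one_pCons)
  have G_Suc: "G0 (Suc n) = subst3 (G0 n, G1 n, G2 n) F0" "G1 (Suc n) = subst3 (G0 n, G1 n, G2 n) F1"
    "G2 (Suc n) = subst3 (G0 n, G1 n, G2 n) F2" for n
  proof -
    have "proj_iterate ?F (Suc n) = proj_comp ?F (proj_iterate ?F n)" by (simp add: proj_iterate_def)
    then show "G0 (Suc n) = subst3 (G0 n, G1 n, G2 n) F0" "G1 (Suc n) = subst3 (G0 n, G1 n, G2 n) F1"
      "G2 (Suc n) = subst3 (G0 n, G1 n, G2 n) F2"
      by (simp_all add: G proj_comp_def)
  qed
  have G0_Suc': "G0 (Suc n) = subst3 ?F (G0 n)" for n
    using proj_iterate_Suc_right[of ?F n] by (simp add: G proj_comp_def)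
  have nz: "G0 n \<noteq> 0 \<and> homog_fun (e ^ n) (G0 n)" for n
  proof (induction n)
    case 0
    have "G0 0 \<noteq> 0" unfolding G_0 by (simp add: lin3_def)
    moreover have "homog_fun (e ^ 0) (G0 0)" by (simp add: G_0 homog_fun_def)
    ultimately show ?case by blast
  next
    case (Suc n)
    then show ?case
      using dominant_pullback_nonzero[OF F0 F1 F2 l det, of "e ^ n" "G0 n"]
        homog_fun_subst3[OF _ hom, of "e ^ n" "G0 n"] by (simp add: G0_Suc')
  qed
  define \<mu> where "\<mu> = \<alpha> 0 - l * \<gamma> 0"
  define z where "z n = dehom (G0 n)" for n
  define x where "x n = const2 (\<gamma> 0) * dehom (G0 n) + const2 (\<gamma> 1) * dehom (G1 n) + const2 (\<gamma> 2) * dehom (G2 n)" for n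
  define u where "u n = const2 (1 / l) * (dehom (G1 n) - const2 \<mu> * dehom (G0 n))" for n
  define a b d where "a = \<alpha> 1" "b = \<gamma> 0 + \<gamma> 1 * \<mu> + \<beta> 2" "d = (\<beta> 1 * \<gamma> 2 - \<beta> 2 * \<gamma> 1) * l"
  define c where "c = \<gamma> 2 * \<beta> 0 - \<beta> 2 * \<gamma> 0 + (\<beta> 1 * \<gamma> 2 - \<beta> 2 * \<gamma> 1) * \<mu>"
  have eq1: "G1 (Suc n) * G0 n = G0 (Suc n) *
      (subst3 (G0 n, G1 n, G2 n) (lin3 (\<alpha> 0) (\<alpha> 1) (\<alpha> 2)))"
   and eq2: "G2 (Suc n) * (subst3 (G0 n, G1 n, G2 n) (lin3 (\<gamma> 0) (\<gamma> 1) (\<gamma> 2))) = G0 (Suc n) *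
      (subst3 (G0 n, G1 n, G2 n) (lin3 (\<beta> 0) (\<beta> 1) (\<beta> 2)))" for n
  proof -
    have F1': "eval3 F1 p q r * p = eval3 F0 p q r * (\<alpha> 0 * p + \<alpha> 1 * q + \<alpha> 2 * r)" for p q r
      using arg_cong[OF F1, of "\<lambda>P. eval3 P p q r"] by simp
    have F2': "eval3 F2 p q r * (\<gamma> 0 * p + \<gamma> 1 * q + \<gamma> 2 * r) =
        eval3 F0 p q r * (\<beta> 0 * p + \<beta> 1 * q + \<beta> 2 * r)" for p q r
      using arg_cong[OF F2, of "\<lambda>P. eval3 P p q r"] by simp
    show "G1 (Suc n) * G0 n = G0 (Suc n) * (subst3 (G0 n, G1 n, G2 n) (lin3 (\<alpha> 0) (\<alpha> 1) (\<alpha> 2)))"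
      by (rule eval3_cong_imp_eq) (simp add: G_Suc F1')
    show "G2 (Suc n) * (subst3 (G0 n, G1 n, G2 n) (lin3 (\<gamma> 0) (\<gamma> 1) (\<gamma> 2))) = G0 (Suc n) *
      (subst3 (G0 n, G1 n, G2 n) (lin3 (\<beta> 0) (\<beta> 1) (\<beta> 2)))"
      by (rule eval3_cong_imp_eq) (simp add: G_Suc F2'[simplified])
  qed
  have u_rec: "u (Suc n) * z n = z (Suc n) * x n" for n
  proof (rule eval2_cong_imp_eq)
    fix s t
    let ?e = "\<lambda>P. eval3 P 1 s t"
    have "?e (G1 (Suc n)) * ?e (G0 n) = ?e (G0 (Suc n)) * (\<alpha> 0 * ?e (G0 n) + \<alpha> 1 * ?e (G1 n) + \<alpha> 2 * ?e (G2 n))"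
      using arg_cong[OF eq1, of ?e] by simp
    then have "(?e (G1 (Suc n)) - \<mu> * ?e (G0 (Suc n))) * ?e (G0 n) =
        l * (?e (G0 (Suc n)) * (\<gamma> 0 * ?e (G0 n) + \<gamma> 1 * ?e (G1 n) + \<gamma> 2 * ?e (G2 n)))"
      unfolding \<mu>_def l(2,3) by algebra
    then show "eval2 (u (Suc n) * z n) (s, t) = eval2 (z (Suc n) * x n) (s, t)"
      using l(1) by (simp add: u_def z_def x_def)
  qed
  have x_rec: "x (Suc n) * x n * z n = z (Suc n) *
      (const2 a * x n ^ 2 + const2 b * x n * z n + const2 c * z n ^ 2 + const2 d * u n * z n)" for n
  proof (rule eval2_cong_imp_eq)
    fix s t
    let ?e = "\<lambda>P. eval3 P 1 s t"
    define g0 g1 g2 h0 h1 h2 where g: "g0 = ?e (G0 n)" "g1 = ?e (G1 n)" "g2 = ?e (G2 n)"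
      "h0 = ?e (G0 (Suc n))" "h1 = ?e (G1 (Suc n))" "h2 = ?e (G2 (Suc n))"
    define X where "X = \<gamma> 0 * g0 + \<gamma> 1 * g1 + \<gamma> 2 * g2"
    define U where "U = (g1 - \<mu> * g0) / l"
    have U: "g1 = l * U + \<mu> * g0" using l(1) by (simp add: U_def)
    have h1: "h1 * g0 = h0 * (\<alpha> 0 * g0 + \<alpha> 1 * g1 + \<alpha> 2 * g2)"
      using arg_cong[OF eq1, of ?e] by (simp add: g)
    have h2: "h2 * X = h0 * (\<beta> 0 * g0 + \<beta> 1 * g1 + \<beta> 2 * g2)"
      using arg_cong[OF eq2, of ?e] by (simp add: g X_def)
    have h1': "h1 * g0 = h0 * (\<mu> * g0 + l * X)"
      using h1 unfolding \<mu>_def l(2,3) X_def by algebra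
    have L: "\<gamma> 2 * (\<beta> 0 * g0 + \<beta> 1 * g1 + \<beta> 2 * g2) = c * g0 + \<beta> 2 * X + d * U"
      unfolding c_def a_b_d_def X_def using U by algebra
    have "(\<gamma> 0 * h0 + \<gamma> 1 * h1 + \<gamma> 2 * h2) * X * g0 =
        \<gamma> 0 * h0 * X * g0 + \<gamma> 1 * X * (h1 * g0) + \<gamma> 2 * g0 * (h2 * X)"
      by algebra
    also have "\<dots> = h0 * (\<gamma> 0 * X * g0 + \<gamma> 1 * X * (\<mu> * g0 + l * X)
        + g0 * (\<gamma> 2 * (\<beta> 0 * g0 + \<beta> 1 * g1 + \<beta> 2 * g2)))"
      unfolding h1' h2 by algebra
    also have "\<dots> = h0 * (a * X ^ 2 + b * X * g0 + c * g0 ^ 2 + d * U * g0)"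
      unfolding L a_b_d_def(1,2) l(2) by algebra
    finally show "eval2 (x (Suc n) * x n * z n) (s, t) = eval2 (z (Suc n) *
      (const2 a * x n ^ 2 + const2 b * x n * z n + const2 c * z n ^ 2 + const2 d * u n * z n)) (s, t)"
      by (simp add: z_def x_def u_def g X_def U_def)
  qed
  have init: "z 0 = 1" "u 0 = lin2 (- \<mu> / l) (1 / l) 0" "x 0 = lin2 (\<gamma> 0) (\<gamma> 1) (\<gamma> 2)"
    by (rule eval2_cong_imp_eq; simp add: z_def u_def x_def G_0 field_simps)+
  have "\<exists>P Q. coprime P Q \<and> 2 ^ k \<le> degree Q \<and> x (2 * k + 1) * Q = z (2 * k + 1) * P"
  proof (rule recurrence_growth[OF _ init(1) _ _ _ _ u_rec x_rec])
    show "d \<noteq> 0" using l det by (simp add: a_b_d_def)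
    show "separating (u 0) (x 0)" unfolding init using l \<gamma>2 by (intro separating_linear) auto
    show "degree (u 0) = 0" "degree (x 0) = 1" unfolding init lin2_def using \<gamma>2 by auto
    show "z n \<noteq> 0" for n using nz[of n] dehom_eq_0_imp_eq_0 by (auto simp: z_def)
  qed
  then obtain P Q where PQ: "coprime P Q" "2 ^ k \<le> degree Q" "x (2 * k + 1) * Q = z (2 * k + 1) * P"
    by blast
  have "degree Q \<le> proj_degree (G0 (2 * k + 1), G1 (2 * k + 1), G2 (2 * k + 1))"
    using nz[of "2 * k + 1"] dehom_eq_0_imp_eq_0
    by (intro degree_le_proj_degree[OF _ PQ(1) PQ(3)[unfolded x_def z_def]]) auto
  then show ?thesis using PQ(2) by (simp add: G)
qed

lemma exponential_growth_imp_dynamical_degree_gt_1: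
  assumes "has_dynamical_degree F \<delta>" "\<And>k. 2 ^ k \<le> proj_degree (proj_iterate F (2 * k + 1))"
  shows "\<delta> > 1"
proof -
  define D where "D n = real (proj_degree (proj_iterate F n))" for n
  have "(\<lambda>n. root n (D n)) \<longlonglongrightarrow> \<delta>" using assms(1) by (simp add: has_dynamical_degree_def D_def)
  then have lim: "(\<lambda>k. root (2 * k + 1) (D (2 * k + 1))) \<longlonglongrightarrow> \<delta>"
    by (rule LIMSEQ_subseq_LIMSEQ[unfolded o_def]) (simp add: strict_mono_def)
  \<comment> \<open>\<open>2\<^sup>k\<close> is the \<open>3k\<close>-th power of the cube root of \<open>2\<close>, and \<open>2k + 1 \<le> 3k\<close> for \<open>k \<ge> 1\<close>\<close>
  define r :: real where "r = root 3 2"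
  have r: "r > 1" "r ^ 3 = 2" by (simp_all add: r_def)
  have "r \<le> root (2 * k + 1) (D (2 * k + 1))" if "k \<ge> 1" for k
  proof -
    have "r ^ (2 * k + 1) \<le> r ^ (3 * k)" using r that by (intro power_increasing) auto
    also have "\<dots> = 2 ^ k" by (simp add: power_mult r)
    also have "\<dots> \<le> D (2 * k + 1)"
      using assms(2)[of k] unfolding D_def by (metis of_nat_le_iff of_nat_numeral of_nat_power)
    finally have "root (2 * k + 1) (r ^ (2 * k + 1)) \<le> root (2 * k + 1) (D (2 * k + 1))"
      by (intro real_root_le_mono) auto
    moreover have "root (2 * k + 1) (r ^ (2 * k + 1)) = r"
      using r by (intro real_root_power_cancel) auto
    ultimately show ?thesis by linarith
  qed
  then have "r \<le> \<delta>" by (intro LIMSEQ_le_const[OF lim]) blast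
  then show ?thesis using r by simp
qed

text \<open>
  The given extension agrees with \<open>f\<close> off a curve only. Since polynomials are determined there, it
  satisfies the two cross-multiplied identities in the affine chart, and homogeneity carries them over to
  the projective plane.
\<close>

lemma entropy_nonzero:
  fixes \<alpha> \<beta> \<gamma> :: "nat \<Rightarrow> complex"
  assumes l: "l \<noteq> 0" "\<alpha> 1 = l * \<gamma> 1" "\<alpha> 2 = l * \<gamma> 2"
    and \<gamma>2: "\<gamma> 2 \<noteq> 0"
    and det: "\<beta> 1 * \<gamma> 2 - \<beta> 2 * \<gamma> 1 \<noteq> 0"
  shows "\<not> has_algebraic_entropy (family_map \<alpha> \<beta> \<gamma>) 0"
proof
  assume "has_algebraic_entropy (family_map \<alpha> \<beta> \<gamma>) 0"
  then obtain F0 F1 F2 \<delta> where ext: "proj_extension (family_map \<alpha> \<beta> \<gamma>) (F0, F1, F2)"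
    and \<delta>: "has_dynamical_degree (F0, F1, F2) \<delta>" "ln \<delta> = 0"
    unfolding has_algebraic_entropy_def by (metis prod_cases3)
  from ext obtain e where "homogeneous e F0" "homogeneous e F1" "homogeneous e F2"
    by (auto simp: proj_extension_def)
  then have hom: "homog_fun e F0" "homog_fun e F1" "homog_fun e F2"
    by (auto intro: homogeneous_imp_homog_fun)
  from ext have off: "off_curve (\<lambda>(x, y). eval3 F0 1 x y \<noteq> 0 \<and> family_map \<alpha> \<beta> \<gamma> (x, y) =
      (eval3 F1 1 x y / eval3 F0 1 x y, eval3 F2 1 x y / eval3 F0 1 x y))"
    by (simp add: proj_extension_def)
  then have F0: "F0 \<noteq> 0" using off_curve_ex by fastforce
  have "off_curve (\<lambda>z. eval2 (lin2 (\<gamma> 0) (\<gamma> 1) (\<gamma> 2)) z \<noteq> 0)"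
    using \<gamma>2 by (intro off_curve_nonzero) (simp add: lin2_def)
  note off = off_curve_conj[OF off this]
  have "dehom F1 = dehom F0 * lin2 (\<alpha> 0) (\<alpha> 1) (\<alpha> 2)"
    by (rule off_curve_eq_imp_eq, rule off_curve_mono[OF off])
      (auto simp: family_map_def field_simps)
  then have id1: "eval3 F1 1 x y = eval3 F0 1 x y * (\<alpha> 0 + \<alpha> 1 * x + \<alpha> 2 * y)" for x y
    by (metis eval2_dehom eval2_lin2 eval2_mult fst_conv snd_conv)
  have "dehom F2 * lin2 (\<gamma> 0) (\<gamma> 1) (\<gamma> 2) = dehom F0 * lin2 (\<beta> 0) (\<beta> 1) (\<beta> 2)"
    by (rule off_curve_eq_imp_eq, rule off_curve_mono[OF off])
      (auto simp: family_map_def frac_eq_eq mult.commute)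
  then have id2: "eval3 F2 1 x y * (\<gamma> 0 + \<gamma> 1 * x + \<gamma> 2 * y) =
      eval3 F0 1 x y * (\<beta> 0 + \<beta> 1 * x + \<beta> 2 * y)" for x y
    by (metis eval2_dehom eval2_lin2 eval2_mult fst_conv snd_conv)
  have lin: "p * (t * x) + q * (t * y) + r * (t * z) = t * (p * x + q * y + r * z)" for p q r t x y z :: complex
    by (simp add: algebra_simps)
  have "homog_fun (e + 1) (F1 * lin3 1 0 0 - F0 * lin3 (\<alpha> 0) (\<alpha> 1) (\<alpha> 2))"
    using hom by (simp add: homog_fun_def lin) (simp add: algebra_simps)
  moreover have "dehom (F1 * lin3 1 0 0 - F0 * lin3 (\<alpha> 0) (\<alpha> 1) (\<alpha> 2)) = 0"
    by (rule eval2_cong_imp_eq) (simp add: id1)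
  ultimately have F1: "F1 * lin3 1 0 0 = F0 * lin3 (\<alpha> 0) (\<alpha> 1) (\<alpha> 2)"
    using dehom_eq_0_imp_eq_0 by fastforce
  have "homog_fun (e + 1) (F2 * lin3 (\<gamma> 0) (\<gamma> 1) (\<gamma> 2) - F0 * lin3 (\<beta> 0) (\<beta> 1) (\<beta> 2))"
    using hom by (simp add: homog_fun_def lin) (simp add: algebra_simps)
  moreover have "dehom (F2 * lin3 (\<gamma> 0) (\<gamma> 1) (\<gamma> 2) - F0 * lin3 (\<beta> 0) (\<beta> 1) (\<beta> 2)) = 0"
    by (rule eval2_cong_imp_eq) (simp add: id2[simplified])
  ultimately have F2: "F2 * lin3 (\<gamma> 0) (\<gamma> 1) (\<gamma> 2) = F0 * lin3 (\<beta> 0) (\<beta> 1) (\<beta> 2)"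
    using dehom_eq_0_imp_eq_0 by fastforce
  have "\<delta> > 1"
    using \<delta>(1) iterate_degree_growth[OF F0 F1 F2 hom l \<gamma>2 det]
    by (rule exponential_growth_imp_dynamical_degree_gt_1)
  then show False using \<delta>(2) by simp
qed

section \<open>Uniqueness of the invariant fibration\<close>

text \<open>
  The degree of the rational function \<open>P / Q\<close> when \<open>P\<close> and \<open>Q\<close> are coprime; it is invariant under
  Moebius transformations.
\<close>

definition pair_degree :: "'a::idom poly \<Rightarrow> 'a poly \<Rightarrow> nat" where
  "pair_degree P Q = max (degree P) (degree Q)"

lemma pair_degree_linear_combination:
  fixes P Q :: "'a::idom poly"
  assumes "a * d - b * c \<noteq> 0"
  shows "pair_degree (smult a P + smult b Q) (smult c P + smult d Q) = pair_degree P Q"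
proof -
  have le: "pair_degree (smult a P + smult b Q) (smult c P + smult d Q) \<le> pair_degree P Q"
    for a b c d and P Q :: "'a poly"
  proof -
    have "degree (smult r P + smult s Q) \<le> max (degree P) (degree Q)" for r s
      using degree_add_le_max[of "smult r P" "smult s Q"] degree_smult_le[of r P] degree_smult_le[of s Q]
      by linarith
    then show ?thesis by (simp add: pair_degree_def)
  qed
  let ?R = "smult a P + smult b Q" and ?S = "smult c P + smult d Q"
  have "smult d ?R + smult (- b) ?S = smult (a * d - b * c) P"
    "smult (- c) ?R + smult a ?S = smult (a * d - b * c) Q"
    by (simp_all add: smult_add_right smult_diff_left algebra_simps)
  then have "pair_degree P Q = pair_degree (smult d ?R + smult (- b) ?S) (smult (- c) ?R + smult a ?S)"
    using assms by (simp add: pair_degree_def)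
  also have "\<dots> \<le> pair_degree ?R ?S" by (rule le)
  finally show ?thesis using le[of a P b Q c d] by linarith
qed

lemma pair_degree_mult:
  fixes P Q T :: "'a::idom poly"
  assumes "T \<noteq> 0" "P \<noteq> 0 \<or> Q \<noteq> 0"
  shows "pair_degree (T * P) (T * Q) = degree T + pair_degree P Q"
  using assms by (cases "P = 0"; cases "Q = 0") (auto simp: pair_degree_def degree_mult_eq)

lemma linear_combination_nonzero:
  fixes P Q :: "'a::idom poly"
  assumes "a * d - b * c \<noteq> 0" "P \<noteq> 0 \<or> Q \<noteq> 0"
  shows "smult a P + smult b Q \<noteq> 0 \<or> smult c P + smult d Q \<noteq> 0"
proof (rule ccontr)
  assume "\<not> ?thesis"
  then have 0: "smult a P + smult b Q = 0" "smult c P + smult d Q = 0" by auto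
  have "smult (a * d - b * c) P = smult d (smult a P + smult b Q) - smult b (smult c P + smult d Q)"
    "smult (a * d - b * c) Q = smult a (smult c P + smult d Q) - smult c (smult a P + smult b Q)"
    by (simp_all add: smult_add_right smult_diff_left algebra_simps)
  then show False using assms unfolding 0 by simp
qed

text \<open>
  The index \<open>e\<close> is allowed to exceed the degree so that \<open>P\<close> and \<open>Q\<close> can be treated at the same \<open>e\<close>.
\<close>

lemma coeff_skew_subst_top:
  assumes q: "degree q = 1" and e: "degree P \<le> e"
  shows "coeff (skew_subst w q P) e = pcompose (coeff P e) w * coeff q 1 ^ e"
proof -
  let ?M = "map_poly (\<lambda>p. pcompose p w) P"
  have M: "degree ?M \<le> degree P" by (rule degree_le) (auto simp: coeff_map_poly coeff_eq_0)
  show ?thesis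
  proof (cases "degree ?M = e")
    case True
    have "coeff (skew_subst w q P) (degree ?M * degree q) = coeff ?M (degree ?M) * lead_coeff q ^ degree ?M"
      unfolding skew_subst_def
      using lead_coeff_comp[of q ?M] q by (simp add: degree_pcompose)
    then show ?thesis using True q by (simp add: coeff_map_poly)
  next
    case False
    then have less: "degree ?M < e" using M e by linarith
    then have "coeff ?M e = 0" by (rule coeff_eq_0)
    moreover have "coeff (skew_subst w q P) e = 0"
      unfolding skew_subst_def using less q by (intro coeff_eq_0) (simp add: degree_pcompose)
    ultimately show ?thesis by (simp add: coeff_map_poly)
  qed
qed

lemma eval2_smult [simp]: "eval2 (smult p P) z = poly p (fst z) * eval2 P z"
  by (simp add: eval2_def)

text \<open>
  The heart of uniqueness. Let \<open>g(x, y) = (w(x), r(x) + w(x) y)\<close> and suppose that \<open>U = P / Q\<close> satisfies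
  \<open>U \<circ> g = \<phi> \<circ> U\<close> for a Moebius map \<open>\<phi>\<close>, with determinant \<open>\<Delta>\<close>. By coprimality the numerator and denominator
  transform with a common factor \<open>t\<close>, which depends on \<open>x\<close> only because \<open>g\<close> preserves degrees in \<open>y\<close>. Let
  \<open>e\<close> be the degree of \<open>U\<close> in \<open>y\<close>, and let \<open>p, q\<close> be the coefficients of \<open>y\<^sup>e\<close> in \<open>P, Q\<close>, so that \<open>p / q\<close> is the
  restriction of \<open>U\<close> to the invariant section \<open>y = \<infinity>\<close>. Comparing degrees in \<open>x\<close> at \<open>y\<^sup>e\<close> gives
  \<open>deg t = e\<close>. The polynomial \<open>H = q P - p Q\<close>, the numerator of \<open>U - p / q\<close>, satisfies
  \<open>w\<^sup>e (H \<circ> g) = \<Delta> t\<^sup>2 H\<close>; its leading coefficient in \<open>y\<close> yields \<open>e + deg\<^sub>y H = 2 e\<close>, although the degree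
  of \<open>H\<close> in \<open>y\<close> is less than \<open>e\<close> if \<open>H \<noteq> 0\<close>. So \<open>H = 0\<close> and \<open>U = p / q\<close> depends on \<open>x\<close> only.
\<close>

lemma invariant_ratio_degree_0:
  fixes P Q :: "complex poly poly" and w r :: "complex poly" and a b c d :: complex
  assumes w: "degree w = 1" and cop: "coprime P Q" and det: "a * d - b * c \<noteq> 0"
    and inv: "skew_subst w [:r, w:] P * (smult [:c:] P + smult [:d:] Q) =
      skew_subst w [:r, w:] Q * (smult [:a:] P + smult [:b:] Q)"
  shows "degree P = 0 \<and> degree Q = 0"
proof -
  define g where "g = skew_subst w [:r, w:]"
  have qdeg: "degree [:r, w:] = 1" using w by auto
  have det': "[:a:] * [:d:] - [:b:] * [:c:] \<noteq> 0" using det by (simp add: mult.commute[of d] mult.commute[of c])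
  define R S where "R = smult [:a:] P + smult [:b:] Q" and "S = smult [:c:] P + smult [:d:] Q"
  have PQ0: "P \<noteq> 0 \<or> Q \<noteq> 0" using cop by auto
  have RS0: "R \<noteq> 0 \<or> S \<noteq> 0"
    unfolding R_def S_def by (rule linear_combination_nonzero[OF det' PQ0])
  have "coprime R S"
  proof (rule coprimeI)
    fix D assume D: "D dvd R" "D dvd S"
    have "smult [:a * d - b * c:] P = smult [:d:] R - smult [:b:] S"
      "smult [:a * d - b * c:] Q = smult [:a:] S - smult [:c:] R"
      by (rule eval2_cong_imp_eq; simp add: R_def S_def algebra_simps)+
    moreover have "D dvd smult [:d:] R - smult [:b:] S" "D dvd smult [:a:] S - smult [:c:] R"
      using D by (simp_all add: dvd_diff dvd_smult)
    ultimately have "D dvd smult [:a * d - b * c:] P" "D dvd smult [:a * d - b * c:] Q" by simp_all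
    moreover have "D dvd U" if "D dvd smult [:a * d - b * c:] U" for U
    proof -
      have "D dvd smult [:inverse (a * d - b * c):] (smult [:a * d - b * c:] U)"
        using that by (rule dvd_smult)
      also have "smult [:inverse (a * d - b * c):] (smult [:a * d - b * c:] U) = U"
        by (rule eval2_cong_imp_eq) (use det in simp)
      finally show ?thesis .
    qed
    ultimately show "is_unit D" using cop by (meson coprime_common_divisor)
  qed
  have inv': "g P * S = g Q * R" using inv by (simp add: g_def R_def S_def)
  obtain T where T: "g P = T * R" "g Q = T * S"
  proof (cases "R = 0")
    case True
    then have "is_unit S" using \<open>coprime R S\<close> by simp
    then obtain S' where "1 = S * S'" by (rule dvdE)
    then have S': "S' * S = 1" by (simp add: mult.commute)
    have "g P = 0" using inv' True RS0 by auto
    moreover have "g Q = g Q * S' * S" using S' by (simp add: mult.assoc)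
    ultimately show ?thesis using True by (intro that[of "g Q * S'"]) simp_all
  next
    case False
    have "R dvd g P * S" unfolding inv' by (rule dvd_triv_right)
    then have "R dvd g P" using \<open>coprime R S\<close> by (simp add: coprime_dvd_mult_left_iff)
    then obtain T where "g P = R * T" by (rule dvdE)
    then have T: "g P = T * R" by (simp only: mult.commute)
    have "R * (T * S) = R * g Q" using inv' unfolding T by algebra
    then have "g Q = T * S" using False by simp
    then show ?thesis by (rule that[OF T])
  qed
  define e where "e = pair_degree P Q"
  have gdeg: "degree (g U) = degree U" for U
    using w qdeg by (simp add: g_def degree_skew_subst)
  have g0: "g U = 0 \<longleftrightarrow> U = 0" for U using w qdeg by (simp add: g_def skew_subst_eq_0_iff)
  have T0: "T \<noteq> 0"
  proof
    assume "T = 0"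
    then have "g P = 0" "g Q = 0" unfolding T by simp_all
    then show False using PQ0 unfolding g0 by simp
  qed
  have "pair_degree (T * R) (T * S) = e"
    unfolding T[symmetric] pair_degree_def gdeg e_def by (rule refl)
  moreover have "pair_degree R S = e"
    unfolding R_def S_def e_def by (rule pair_degree_linear_combination[OF det'])
  ultimately have "degree T = 0" using pair_degree_mult[OF T0 RS0] by simp
  then obtain t where t: "T = [:t:]" by (rule degree_eq_zeroE)
  have t0: "t \<noteq> 0" using T0 t by simp
  define p q where "p = coeff P e" and "q = coeff Q e"
  have pq0: "p \<noteq> 0 \<or> q \<noteq> 0"
  proof (rule ccontr)
    assume "\<not> (p \<noteq> 0 \<or> q \<noteq> 0)"
    then have 0: "coeff P e = 0" "coeff Q e = 0" by (auto simp: p_def q_def)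
    have le: "degree P \<le> e" "degree Q \<le> e" "e = degree P \<or> e = degree Q"
      by (auto simp: e_def pair_degree_def max_def)
    have "e = 0"
      using le(3) 0 by auto
    then have "lead_coeff P = 0" "lead_coeff Q = 0" using le 0 by simp_all
    then show False using PQ0 by simp
  qed
  have Pe: "degree P \<le> e" "degree Q \<le> e" by (auto simp: e_def pair_degree_def)
  have top: "coeff (g U) n = pcompose (coeff U n) w * w ^ n" if "degree U \<le> n" for U n
    using coeff_skew_subst_top[OF qdeg that, of w] by (simp add: g_def)
  have p1: "pcompose p w * w ^ e = t * (smult a p + smult b q)"
    using top[OF Pe(1)] T(1) by (simp add: t R_def p_def q_def)
  have q1: "pcompose q w * w ^ e = t * (smult c p + smult d q)"
    using top[OF Pe(2)] T(2) by (simp add: t S_def p_def q_def)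
  have w0: "w \<noteq> 0" using w by auto
  have "pair_degree (pcompose p w) (pcompose q w) = pair_degree p q"
    using w by (simp add: pair_degree_def degree_pcompose)
  moreover have "pcompose p w \<noteq> 0 \<or> pcompose q w \<noteq> 0" using pq0 w by (simp add: pcompose_eq_0_iff)
  ultimately have "pair_degree (w ^ e * pcompose p w) (w ^ e * pcompose q w) = e + pair_degree p q"
    using w0 w by (subst pair_degree_mult) (auto simp: degree_power_eq)
  moreover have "pair_degree (t * (smult a p + smult b q)) (t * (smult c p + smult d q)) =
      degree t + pair_degree p q"
    using pair_degree_mult[OF t0 linear_combination_nonzero[OF det pq0]]
      pair_degree_linear_combination[OF det] by metis
  ultimately have degt: "degree t = e" using p1 q1 by (simp add: mult.commute)
  define H where "H = smult q P - smult p Q"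
  have "H = 0"
  proof (rule ccontr)
    assume H0: "H \<noteq> 0"
    have "smult (w ^ e) (g H) = smult (pcompose q w * w ^ e) (g P) - smult (pcompose p w * w ^ e) (g Q)"
      by (rule eval2_cong_imp_eq) (simp add: H_def g_def poly_pcompose algebra_simps)
    also have "\<dots> = smult (smult (a * d - b * c) (t ^ 2)) H"
      unfolding p1 q1 T t H_def R_def S_def
      by (rule eval2_cong_imp_eq) (simp add: algebra_simps power2_eq_square)
    finally have *: "coeff (smult (w ^ e) (g H)) (degree H) =
        coeff (smult (smult (a * d - b * c) (t ^ 2)) H) (degree H)" by simp
    define h where "h = lead_coeff H"
    have h0: "h \<noteq> 0" using H0 by (simp add: h_def)
    have "w ^ e * (pcompose h w * w ^ degree H) = smult (a * d - b * c) (t ^ 2) * h"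
      using * by (simp add: top h_def)
    then have "degree (w ^ e * (pcompose h w * w ^ degree H)) = degree (smult (a * d - b * c) (t ^ 2) * h)"
      by simp
    then have "e + (degree h + degree H) = 2 * e + degree h"
      using h0 w0 t0 det w degt
      by (simp add: degree_mult_eq degree_power_eq degree_pcompose pcompose_eq_0_iff)
    then have "degree H = e" by simp
    moreover have "coeff H e = 0" by (simp add: H_def p_def q_def)
    ultimately show False using H0 by (metis leading_coeff_0_iff)
  qed
  then have HQ: "smult q P = smult p Q" by (simp add: H_def)
  have deg0: "degree B = 0" if "coprime A B" "smult r A = smult s B" "r \<noteq> 0" for A B :: "complex poly poly" and r s
  proof -
    have "B dvd [:r:] * A" using that(2) by (simp add: dvd_smult)
    moreover have "coprime B A" using that(1) by (simp add: coprime_commute)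
    ultimately have "B dvd [:r:]" by (rule coprime_dvd_mult_left_iff[THEN iffD1, rotated])
    then show ?thesis using dvd_imp_degree_le[of B "[:r:]"] that(3) by simp
  qed
  show ?thesis
  proof (cases "q = 0")
    case True
    then have "p \<noteq> 0" using pq0 by simp
    then have Q0: "Q = 0" using HQ True by simp
    then have "is_unit P" using cop by simp
    then show ?thesis using Q0 by (auto simp: is_unit_poly_iff)
  next
    case False
    then have Q: "degree Q = 0" using deg0[OF cop HQ] by simp
    show ?thesis
    proof (cases "p = 0")
      case True
      then show ?thesis using HQ False Q by simp
    next
      case False
      then show ?thesis using deg0[OF _ HQ[symmetric]] cop Q by (simp add: coprime_commute)
    qed
  qed
qed

section \<open>Fibres and invariant fibrations\<close>

lemma coprime_representation_exists:
  assumes "rational_function U"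
  shows "\<exists>P Q. represents P Q U \<and> coprime P Q"
proof -
  obtain P Q where PQ: "Q \<noteq> 0" "off_curve (\<lambda>z. U z = eval2 P z / eval2 Q z)"
    using assms by (auto simp: rational_function_def represents_def)
  obtain P' Q' where P': "P = P' * gcd P Q" "Q = Q' * gcd P Q" "coprime P' Q'"
    using gcd_coprime_exists[of P Q] PQ(1) by auto
  define h where "h = gcd P Q"
  have h: "h \<noteq> 0" "P = P' * h" "Q = Q' * h" using PQ(1) P' by (auto simp: h_def)
  have "off_curve (\<lambda>z. U z = eval2 P' z / eval2 Q' z)"
    by (rule off_curve_mono[OF off_curve_conj[OF PQ(2) off_curve_nonzero[OF h(1)]]]) (auto simp: h)
  then show ?thesis using P'(3) PQ(1) h(3) by (intro exI[of _ P'] exI[of _ Q']) (auto simp: represents_def)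
qed

lemma nonconstant_imp_combination_nonzero:
  assumes rep: "represents P Q U" and nc: "nonconstant U" and st: "s \<noteq> 0 \<or> t \<noteq> 0"
  shows "const2 s * P + const2 t * Q \<noteq> 0"
proof
  assume 0: "const2 s * P + const2 t * Q = 0"
  have Q: "Q \<noteq> 0" and off: "off_curve (\<lambda>z. U z = eval2 P z / eval2 Q z)"
    using rep by (auto simp: represents_def)
  have e: "s * eval2 P z + t * eval2 Q z = 0" for z
    using arg_cong[OF 0, of "\<lambda>P. eval2 P z"] by simp
  have "s \<noteq> 0"
  proof
    assume "s = 0"
    then have "eval2 Q z = 0" for z using e[of z] st by simp
    then show False using Q eval2_cong_imp_eq[of Q 0] by simp
  qed
  have "off_curve (\<lambda>z. U z = - t / s)"
  proof (rule off_curve_mono[OF off_curve_conj[OF off off_curve_nonzero[OF Q]]])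
    fix z assume "U z = eval2 P z / eval2 Q z \<and> eval2 Q z \<noteq> 0"
    moreover have "s * eval2 P z = - t * eval2 Q z" using e[of z] by (simp add: eq_neg_iff_add_eq_0)
    then have "eval2 P z = (- t * eval2 Q z) / s" using \<open>s \<noteq> 0\<close> by (metis nonzero_mult_div_cancel_left)
    ultimately show "U z = - t / s" by simp
  qed
  then show False using nc by (auto simp: nonconstant_def)
qed

text \<open>
  A factor of a polynomial in \<open>x\<close> is a polynomial in \<open>x\<close>; if irreducible, it is linear.
\<close>

lemma zero_set_irreducible_in_x:
  assumes "irreducible h" "h dvd [:r:]" "r \<noteq> 0"
  shows "\<exists>k. zero_set h = {z. fst z = k}"
proof -
  have "degree h = 0" using dvd_imp_degree_le[OF assms(2)] assms(3) by simp
  then obtain h0 where h0: "h = [:h0:]" by (rule degree_eq_zeroE)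
  then have irr: "irreducible h0" using assms(1) by (simp add: irreducible_const_poly_iff)
  have "degree h0 \<noteq> 0"
  proof
    assume "degree h0 = 0"
    then obtain c where "h0 = [:c:]" by (rule degree_eq_zeroE)
    with irr show False by (auto simp: irreducible_def is_unit_const_poly_iff dvd_field_iff)
  qed
  then have "\<not> constant (poly h0)" by (simp add: constant_degree)
  then obtain k where "poly h0 k = 0" using fundamental_theorem_of_algebra by blast
  then obtain m where m: "h0 = [:- k, 1:] * m" unfolding poly_eq_0_iff_dvd by (rule dvdE)
  moreover have "\<not> [:- k, 1:] dvd 1" by (simp add: is_unit_poly_iff)
  ultimately have "m dvd 1" using irreducibleD[OF irr m] by blast
  then obtain c where "m = [:c:]" "c \<noteq> 0" by (auto simp: is_unit_poly_iff dvd_field_iff)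
  then have "zero_set h = {z. fst z = k}" by (auto simp: zero_set_def h0 m)
  then show ?thesis by blast
qed

text \<open>
  For \<open>U = p(x) / q(x)\<close> every fibre is a component of some \<open>s p(x) = t q(x)\<close>, hence a vertical line;
  the line \<open>x = k\<close> arises from \<open>[s : t] = [q(k) : p(k)]\<close>.
\<close>

lemma fibres_eq_vertical_lines:
  assumes rat: "rational_function U" and nc: "nonconstant U"
    and deg: "\<And>P Q. represents P Q U \<Longrightarrow> coprime P Q \<Longrightarrow> degree P = 0 \<and> degree Q = 0"
  shows "fibres U = {{z. fst z = k} | k. True}"
proof (intro set_eqI iffI)
  fix L assume "L \<in> fibres U"
  then obtain h P Q s t where L: "L = zero_set h" "represents P Q U" "coprime P Q" "(s, t) \<noteq> (0, 0)"
    "irreducible h" "h dvd const2 s * P - const2 t * Q"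
    unfolding fibres_def by blast
  obtain p q where pq: "P = [:p:]" "Q = [:q:]"
    using deg[OF L(2,3)] by (metis degree_eq_zeroE)
  have "const2 s * P + const2 (- t) * Q \<noteq> 0"
    using L(4) by (intro nonconstant_imp_combination_nonzero[OF L(2) nc]) auto
  moreover have "const2 s * P + const2 (- t) * Q = [:smult s p - smult t q:]"
    "const2 s * P - const2 t * Q = [:smult s p - smult t q:]"
    by (simp_all add: pq const2_def)
  ultimately show "L \<in> {{z. fst z = k} | k. True}"
    using zero_set_irreducible_in_x[OF L(5)] L(1,6) by fastforce
next
  fix L :: "(complex \<times> complex) set" assume "L \<in> {{z. fst z = k} | k. True}"
  then obtain k where k: "L = {z. fst z = k}" by blast
  obtain P Q where PQ: "represents P Q U" "coprime P Q"
    using coprime_representation_exists[OF rat] by blast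
  obtain p q where pq: "P = [:p:]" "Q = [:q:]"
    using deg[OF PQ] by (metis degree_eq_zeroE)
  let ?h = "[:[:- k, 1:]:] :: complex poly poly"
  have irr: "irreducible ?h"
    by (simp add: irreducible_const_poly_iff irreducible_linear_field_poly)
  have dvd: "?h dvd [:r:] \<longleftrightarrow> poly r k = 0" for r
    by (auto simp: const_poly_dvd_iff poly_eq_0_iff_dvd coeff_pCons split: nat.splits)
  have "(poly q k, poly p k) \<noteq> (0, 0)"
  proof
    assume 0: "(poly q k, poly p k) = (0, 0)"
    have "?h dvd P" "?h dvd Q" unfolding pq dvd using 0 by simp_all
    then have "is_unit ?h" using PQ(2) by (meson coprime_common_divisor)
    then show False using irr by (simp add: irreducible_def)
  qed
  moreover have "?h dvd const2 (poly q k) * P - const2 (poly p k) * Q"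
    using dvd[of "smult (poly q k) p - smult (poly p k) q"] by (simp add: pq const2_def)
  moreover have "L = zero_set ?h" by (auto simp: k zero_set_def)
  ultimately show "L \<in> fibres U" unfolding fibres_def using PQ irr by blast
qed

text \<open>
  The inverse of the normal form is the polynomial map \<open>g(x, y) = (w(x), w(x) y - b\<^sub>0)\<close> with
  \<open>w(x) = (x - a\<^sub>0) / a\<^sub>1\<close>, which is more convenient for substitution. Pulling the invariance of \<open>U\<close> back
  along \<open>g\<close> gives a polynomial identity.
\<close>

lemma invariant_fibration_is_vertical:
  assumes a1: "a1 \<noteq> 0" and pres: "preserves_fibration (normal_form a0 a1 b0) U"
  shows "fibres U = {{z. fst z = k} | k. True}"
proof -
  let ?f = "normal_form a0 a1 b0"
  from pres obtain a b c d where rat: "rational_function U" and nc: "nonconstant U"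
    and det: "a * d - b * c \<noteq> 0"
    and inv: "off_curve (\<lambda>z. U (?f z) = (a * U z + b) / (c * U z + d))"
    unfolding preserves_fibration_def by blast
  define w where "w = [:- a0 / a1, 1 / a1:]"
  define r where "r = [:- b0:]"
  define g where "g z = (poly w (fst z), eval2 [:r, w:] z)" for z
  have w: "degree w = 1" using a1 by (simp add: w_def)
  have q: "degree [:r, w:] = 1" using w by auto
  have fg: "?f (g z) = z" if "poly w (fst z) \<noteq> 0" for z
  proof -
    have "eval2 [:r, w:] z = poly w (fst z) * snd z - b0"
      by (simp add: eval2_def r_def algebra_simps)
    moreover have "a0 + a1 * poly w (fst z) = fst z" using a1 by (simp add: w_def field_simps)
    ultimately show ?thesis using that by (cases z) (simp add: normal_form_def g_def)
  qed
  have "degree P = 0 \<and> degree Q = 0" if rep: "represents P Q U" and cop: "coprime P Q" for P Q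
  proof -
    have Q: "Q \<noteq> 0" and U: "off_curve (\<lambda>z. U z = eval2 P z / eval2 Q z)"
      using rep by (auto simp: represents_def)
    \<comment> \<open>the denominator of \<open>\<phi> \<circ> U\<close> vanishes on a curve at most, since \<open>U\<close> is not constant\<close>
    have "const2 c * P + const2 d * Q \<noteq> 0"
      using det by (intro nonconstant_imp_combination_nonzero[OF rep nc]) auto
    from off_curve_nonzero[OF this] have cd: "off_curve (\<lambda>z. c * eval2 P z + d * eval2 Q z \<noteq> 0)"
      by simp
    have good: "off_curve (\<lambda>z. U z = eval2 P z / eval2 Q z \<and> eval2 Q z \<noteq> 0)"
      using U off_curve_nonzero[OF Q] by (rule off_curve_conj)
    have pullback: "off_curve (\<lambda>z. R (g z))" if "off_curve R" for R
      using off_curve_skew[OF that, of w "[:r, w:]"] w q by (simp add: g_def)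
    have "off_curve (\<lambda>z. poly w (fst z) \<noteq> 0)"
    proof -
      have "[:w:] \<noteq> 0" using w by auto
      from off_curve_nonzero[OF this] show ?thesis by simp
    qed
    note off = off_curve_conj[OF off_curve_conj[OF off_curve_conj[OF good pullback[OF good]] 
      off_curve_conj[OF pullback[OF inv] pullback[OF cd]]] this]
    have "skew_subst w [:r, w:] P * (smult [:- c:] P + smult [:a:] Q) =
      skew_subst w [:r, w:] Q * (smult [:d:] P + smult [:- b:] Q)"
    proof (rule off_curve_eq_imp_eq, rule off_curve_mono[OF off])
      fix z
      assume asm: "(((U z = eval2 P z / eval2 Q z \<and> eval2 Q z \<noteq> 0) \<and>
        (U (g z) = eval2 P (g z) / eval2 Q (g z) \<and> eval2 Q (g z) \<noteq> 0)) \<and>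
        (U (?f (g z)) = (a * U (g z) + b) / (c * U (g z) + d) \<and>
         c * eval2 P (g z) + d * eval2 Q (g z) \<noteq> 0)) \<and> poly w (fst z) \<noteq> 0" 
      define p1 q1 p2 q2 where "p1 = eval2 P z" "q1 = eval2 Q z" "p2 = eval2 P (g z)" "q2 = eval2 Q (g z)"
      note defs = p1_q1_p2_q2_def
      have nz: "q1 \<noteq> 0" "q2 \<noteq> 0" "c * p2 + d * q2 \<noteq> 0" using asm by (auto simp: defs)
      have "p1 / q1 = (a * (p2 / q2) + b) / (c * (p2 / q2) + d)"
      proof -
        have "?f (g z) = z" using asm by (intro fg) blast
        moreover have "U z = p1 / q1" "U (g z) = p2 / q2"
          "U (?f (g z)) = (a * U (g z) + b) / (c * U (g z) + d)"
          unfolding defs using asm by blast+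
        ultimately show ?thesis by (simp only:)
      qed
      also have "\<dots> = (a * p2 + b * q2) / (c * p2 + d * q2)"
      proof -
        have e: "a * (p2 / q2) + b = (a * p2 + b * q2) / q2" "c * (p2 / q2) + d = (c * p2 + d * q2) / q2"
          using nz(2) by (simp_all add: add_divide_distrib)
        have "(s / q2) / (t / q2) = s / t" for s t using nz(2) by simp
        then show ?thesis unfolding e .
      qed
      finally have "p1 * (c * p2 + d * q2) = q1 * (a * p2 + b * q2)"
        using nz by (simp add: frac_eq_eq mult.commute)
      \<comment> \<open>solved for \<open>p2 / q2 = U (g z)\<close>, which inverts the Moebius map\<close>
      then have "p2 * (- c * p1 + a * q1) = q2 * (d * p1 + - b * q1)" by algebra
      then show "eval2 (skew_subst w [:r, w:] P * (smult [:- c:] P + smult [:a:] Q)) z =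
          eval2 (skew_subst w [:r, w:] Q * (smult [:d:] P + smult [:- b:] Q)) z"
        by (simp add: defs g_def)
    qed
    moreover have "d * a - (- b) * (- c) \<noteq> 0" using det by (simp add: mult.commute)
    ultimately show ?thesis using invariant_ratio_degree_0[OF w cop, of d a "- b" "- c" r] by blast
  qed
  with rat nc show ?thesis by (rule fibres_eq_vertical_lines)
qed

lemma polynomial_in_x_nonconstant:
  assumes "degree p > 0"
  shows "rational_function (\<lambda>(x, y). poly p x) \<and> nonconstant (\<lambda>(x, y). poly p x)"
proof
  have "represents [:p:] 1 (\<lambda>(x, y). poly p x)"
    by (auto simp: represents_def intro!: off_curve_all)
  then show "rational_function (\<lambda>(x, y). poly p x)" by (auto simp: rational_function_def)
  show "nonconstant (\<lambda>(x, y). poly p x)"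
    unfolding nonconstant_def
  proof
    assume "\<exists>c. off_curve (\<lambda>z. (case z of (x, y) \<Rightarrow> poly p x) = c)"
    then obtain c where "off_curve (\<lambda>z. (case z of (x, y) \<Rightarrow> poly p x) = c)" by blast
    then have "off_curve (\<lambda>z. eval2 [:p:] z = eval2 [:[:c:]:] z)"
      by (rule off_curve_mono) auto
    then have "[:p:] = [:[:c:]:]" by (rule off_curve_eq_imp_eq)
    then show False using assms by simp
  qed
qed

lemma unique_fibration_normal_form:
  assumes a1: "a1 \<noteq> 0"
  shows "unique_invariant_fibration (normal_form a0 a1 b0) (\<lambda>(x, y). x)"
proof -
  have "preserves_fibration (normal_form a0 a1 b0) (\<lambda>(x, y). x)"
    unfolding preserves_fibration_def
  proof (intro conjI exI)
    show "rational_function (\<lambda>(x, y). x)" "nonconstant (\<lambda>(x, y). x)"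
      using polynomial_in_x_nonconstant[of "[:0, 1:]"] by simp_all
    show "a1 * 1 - a0 * 0 \<noteq> 0" using a1 by simp
    show "off_curve (\<lambda>z. (case normal_form a0 a1 b0 z of (x, y) \<Rightarrow> x) =
        (a1 * (case z of (x, y) \<Rightarrow> x) + a0) / (0 * (case z of (x, y) \<Rightarrow> x) + 1))"
      by (rule off_curve_all) (auto simp: normal_form_def)
  qed
  then show ?thesis
    by (simp add: unique_invariant_fibration_def invariant_fibration_is_vertical[OF a1])
qed

section \<open>First integrals\<close>

lemma affine_funpow:
  "((\<lambda>u. a0 + a1 * u) ^^ i) x = a0 * (\<Sum>j<i. a1 ^ j) + a1 ^ i * (x::complex)"
proof (induction i)
  case (Suc i)
  have "(\<Sum>j<Suc i. a1 ^ j) = 1 + a1 * (\<Sum>j<i. a1 ^ j)"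
    by (subst sum.lessThan_Suc_shift) (simp add: sum_distrib_left)
  then show ?case using Suc by (simp add: algebra_simps)
qed simp

lemma first_integral_normal_form:
  assumes p: "p > 1" "a1 ^ p = 1" "a1 \<noteq> 1"
  shows "first_integral (normal_form a0 a1 b0) (\<lambda>(x, y). \<Prod>i<p. ((\<lambda>u. a0 + a1 * u) ^^ i) x)"
proof -
  let ?m = "\<lambda>u. a0 + a1 * u"
  have a1: "a1 \<noteq> 0" using p by (metis power_0_left not_one_less_zero zero_neq_one)
  define W where "W = (\<Prod>i<p. [:a0 * (\<Sum>j<i. a1 ^ j), a1 ^ i:])"
  have W: "poly W x = (\<Prod>i<p. (?m ^^ i) x)" for x
    by (simp add: W_def poly_prod affine_funpow mult.commute[of x])
  have "degree W = p"
    using a1 by (simp add: W_def degree_prod_eq_sum_degree)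
  then have "rational_function (\<lambda>(x, y). poly W x) \<and> nonconstant (\<lambda>(x, y). poly W x)"
    using p by (intro polynomial_in_x_nonconstant) simp
  moreover have "poly W (?m x) = poly W x" for x
  proof -
    have "(a1 - 1) * (\<Sum>j<p. a1 ^ j) = 0" using p by (simp add: power_diff_1_eq[symmetric])
    then have "(\<Sum>j<p. a1 ^ j) = 0" using p by simp
    then have per: "(?m ^^ p) x = x" using p by (simp add: affine_funpow)
    \<comment> \<open>\<open>m\<close> permutes the \<open>p\<close> factors cyclically\<close>
    obtain q where q: "p = Suc q" using p by (cases p) auto
    have "poly W (?m x) = (\<Prod>i<Suc q. (?m ^^ Suc i) x)" unfolding W q by (simp only: funpow_Suc_right o_apply)
    also have "\<dots> = (\<Prod>i<q. (?m ^^ Suc i) x) * (?m ^^ p) x" by (simp add: q)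
    also have "\<dots> = (?m ^^ 0) x * (\<Prod>i<q. (?m ^^ Suc i) x)" by (simp only: per) simp
    also have "\<dots> = poly W x" unfolding W q by (rule prod.lessThan_Suc_shift[symmetric])
    finally show ?thesis .
  qed
  then have "off_curve (\<lambda>z. (case normal_form a0 a1 b0 z of (x, y) \<Rightarrow> poly W x) =
      (case z of (x, y) \<Rightarrow> poly W x))"
    by (intro off_curve_all) (auto simp: normal_form_def)
  ultimately show ?thesis unfolding first_integral_def W by blast
qed

lemma integrable_normal_form: "integrable (normal_form 0 1 b0)"
proof -
  have "off_curve (\<lambda>z. (case normal_form 0 1 b0 z of (x, y) \<Rightarrow> x) = (case z of (x, y) \<Rightarrow> x))"
    by (rule off_curve_all) (auto simp: normal_form_def)
  then have "first_integral (normal_form 0 1 b0) (\<lambda>(x, y). x)"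
    unfolding first_integral_def using polynomial_in_x_nonconstant[of "[:0, 1:]"] by simp
  then show ?thesis unfolding integrable_def by blast
qed

section \<open>Nondegeneracy and the normal form\<close>

text \<open>
  Off a curve \<open>f\<close> has a left inverse, and a curve and its translate together do not cover the plane.
\<close>

lemma not_birational_if_translation_invariant:
  assumes bir: "birational f" and uv: "(u, v) \<noteq> (0, 0)"
    and inv: "\<And>x y. f (x + u, y + v) = f (x, y)"
  shows False
proof -
  obtain g where "off_curve (\<lambda>z. f (g z) = z \<and> g (f z) = z)"
    using bir by (auto simp: birational_def off_curve_def)
  then have off: "off_curve (\<lambda>z. g (f z) = z)" by (rule off_curve_mono) simp
  let ?q = "[:[:v:], 1:] :: complex poly poly"
  have off': "off_curve (\<lambda>z. g (f (poly [:u, 1:] (fst z), eval2 ?q z)) = (poly [:u, 1:] (fst z), eval2 ?q z))"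
    by (rule off_curve_skew[OF off]) auto
  from off_curve_ex[OF off_curve_conj[OF off off']]
  obtain z where "g (f z) = z"
    and z: "g (f (poly [:u, 1:] (fst z), eval2 ?q z)) = (poly [:u, 1:] (fst z), eval2 ?q z)" by blast
  moreover obtain x y where xy: "z = (x, y)" by (cases z)
  moreover have "(poly [:u, 1:] (fst z), eval2 ?q z) = (x + u, y + v)"
    by (simp add: xy eval2_def add.commute)
  ultimately have "(x + u, y + v) = (x, y)" using inv[of x y] by (simp add: add.commute)
  then show False using uv by simp
qed

text \<open>
  If \<open>\<alpha>\<^sub>1 = \<alpha>\<^sub>2 = 0\<close> the image lies in a line. If \<open>\<beta>\<^sub>1 \<gamma>\<^sub>2 = \<beta>\<^sub>2 \<gamma>\<^sub>1\<close>, all three linear forms are functions of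
  \<open>\<gamma>\<^sub>1 x\<^sub>1 + \<gamma>\<^sub>2 x\<^sub>2\<close>, and \<open>f\<close> is constant in the direction \<open>(\<gamma>\<^sub>2, - \<gamma>\<^sub>1)\<close>.
\<close>

lemma family_map_nondegenerate:
  fixes \<alpha> \<beta> \<gamma> :: "nat \<Rightarrow> complex"
  assumes \<gamma>: "(\<gamma> 1, \<gamma> 2) \<noteq> (0, 0)" and bir: "birational (family_map \<alpha> \<beta> \<gamma>)"
    and par: "\<alpha> 1 * \<gamma> 2 - \<alpha> 2 * \<gamma> 1 = 0"
  shows "(\<exists>l. l \<noteq> 0 \<and> \<alpha> 1 = l * \<gamma> 1 \<and> \<alpha> 2 = l * \<gamma> 2) \<and> \<beta> 1 * \<gamma> 2 - \<beta> 2 * \<gamma> 1 \<noteq> 0"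
proof
  show "\<beta> 1 * \<gamma> 2 - \<beta> 2 * \<gamma> 1 \<noteq> 0"
  proof
    assume det: "\<beta> 1 * \<gamma> 2 - \<beta> 2 * \<gamma> 1 = 0"
    show False
    proof (rule not_birational_if_translation_invariant[OF bir, of "\<gamma> 2" "- \<gamma> 1"])
      show "(\<gamma> 2, - \<gamma> 1) \<noteq> (0, 0)" using \<gamma> by auto
      fix x y
      have "\<alpha> 0 + \<alpha> 1 * (x + \<gamma> 2) + \<alpha> 2 * (y + - \<gamma> 1) = \<alpha> 0 + \<alpha> 1 * x + \<alpha> 2 * y"
        using par by algebra
      moreover have "\<beta> 0 + \<beta> 1 * (x + \<gamma> 2) + \<beta> 2 * (y + - \<gamma> 1) = \<beta> 0 + \<beta> 1 * x + \<beta> 2 * y"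
        using det by algebra
      moreover have "\<gamma> 0 + \<gamma> 1 * (x + \<gamma> 2) + \<gamma> 2 * (y + - \<gamma> 1) = \<gamma> 0 + \<gamma> 1 * x + \<gamma> 2 * y"
        by algebra
      ultimately show "family_map \<alpha> \<beta> \<gamma> (x + \<gamma> 2, y + - \<gamma> 1) = family_map \<alpha> \<beta> \<gamma> (x, y)"
        unfolding family_map_def prod.case by (simp only:)
    qed
  qed
  define l where "l = (if \<gamma> 1 = 0 then \<alpha> 2 / \<gamma> 2 else \<alpha> 1 / \<gamma> 1)"
  have l: "\<alpha> 1 = l * \<gamma> 1" "\<alpha> 2 = l * \<gamma> 2"
    using par \<gamma> by (auto simp: l_def field_simps)
  have "l \<noteq> 0"
  proof
    assume "l = 0"
    then have fst: "fst (family_map \<alpha> \<beta> \<gamma> z) = \<alpha> 0" for z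
      using l by (cases z) (simp add: family_map_def)
    obtain g where "off_curve (\<lambda>z. family_map \<alpha> \<beta> \<gamma> (g z) = z \<and> g (family_map \<alpha> \<beta> \<gamma> z) = z)"
      using bir by (auto simp: birational_def off_curve_def)
    moreover have "off_curve (\<lambda>z. eval2 (lin2 (- \<alpha> 0) 1 0) z \<noteq> 0)"
      by (rule off_curve_nonzero) (simp add: lin2_def)
    ultimately obtain z where "family_map \<alpha> \<beta> \<gamma> (g z) = z" "fst z \<noteq> \<alpha> 0"
      using off_curve_ex[OF off_curve_conj] by fastforce
    then show False using fst[of "g z"] by simp
  qed
  then show "\<exists>l. l \<noteq> 0 \<and> \<alpha> 1 = l * \<gamma> 1 \<and> \<alpha> 2 = l * \<gamma> 2" using l by blast
qed

text \<open>
  The denominator \<open>\<gamma>\<^sub>0 + \<gamma>\<^sub>1 x\<^sub>1\<close>, divided by \<open>\<beta>\<^sub>2\<close>, becomes the new \<open>x\<close>. Subtracting \<open>k = \<beta>\<^sub>1 / \<gamma>\<^sub>1\<close> from \<open>x\<^sub>2\<close>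
  removes the multiple of the denominator that the numerator contains.
\<close>

lemma conjugate_to_normal_form:
  fixes \<alpha> \<beta> \<gamma> :: "nat \<Rightarrow> complex"
  assumes g2: "\<gamma> 2 = 0" and g1: "\<gamma> 1 \<noteq> 0" and a2: "\<alpha> 2 = 0" and b2: "\<beta> 2 \<noteq> 0"
  shows "\<exists>A a0 b0. affine_change A \<and>
    off_curve (\<lambda>z. A (family_map \<alpha> \<beta> \<gamma> z) = normal_form a0 (\<alpha> 1) b0 (A z))"
proof -
  define k where "k = \<beta> 1 / \<gamma> 1"
  define a0 where "a0 = (\<gamma> 0 + \<gamma> 1 * \<alpha> 0 - \<alpha> 1 * \<gamma> 0) / \<beta> 2"
  define b0 where "b0 = (\<beta> 0 - k * \<gamma> 0) / \<beta> 2 + k"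
  define A :: plane_map where
    "A = (\<lambda>(x, y). (\<gamma> 1 / \<beta> 2 * x + 0 * y + \<gamma> 0 / \<beta> 2, 0 * x + 1 * y + - k))"
  have "affine_change A"
    unfolding affine_change_def A_def
    by (rule exI[of _ "\<gamma> 1 / \<beta> 2"], rule exI[of _ 0], rule exI[of _ 0], rule exI[of _ 1],
        rule exI[of _ "\<gamma> 0 / \<beta> 2"], rule exI[of _ "- k"]) (use g1 b2 in simp)
  moreover have "off_curve (\<lambda>z. A (family_map \<alpha> \<beta> \<gamma> z) = normal_form a0 (\<alpha> 1) b0 (A z))"
  proof (rule off_curve_mono[OF off_curve_nonzero[of "lin2 (\<gamma> 0) (\<gamma> 1) 0"]])
    show "lin2 (\<gamma> 0) (\<gamma> 1) 0 \<noteq> 0" using g1 by (simp add: lin2_def)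
    fix z assume nz: "eval2 (lin2 (\<gamma> 0) (\<gamma> 1) 0) z \<noteq> 0"
    obtain x y where z: "z = (x, y)" by (cases z)
    define X where "X = \<gamma> 0 + \<gamma> 1 * x"
    have X: "X \<noteq> 0" using nz by (simp add: z X_def)
    have k: "\<beta> 1 = k * \<gamma> 1" using g1 by (simp add: k_def)
    have "\<gamma> 1 / \<beta> 2 * (\<alpha> 0 + \<alpha> 1 * x) + \<gamma> 0 / \<beta> 2 = a0 + \<alpha> 1 * (X / \<beta> 2)"
      using b2 by (simp add: a0_def X_def field_simps)
    moreover have "(\<beta> 0 + \<beta> 1 * x + \<beta> 2 * y) / X - k = (b0 + (y - k)) / (X / \<beta> 2)"
    proof -
      have "\<beta> 2 * (b0 + (y - k)) = \<beta> 0 - k * \<gamma> 0 + \<beta> 2 * y"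
        using b2 by (simp add: b0_def field_simps)
      then have "\<beta> 2 * (b0 + (y - k)) = \<beta> 0 + \<beta> 1 * x + \<beta> 2 * y - k * X"
        unfolding k X_def by algebra
      then have "(b0 + (y - k)) / (X / \<beta> 2) = (\<beta> 0 + \<beta> 1 * x + \<beta> 2 * y - k * X) / X"
        by (simp add: mult.commute)
      then show ?thesis using X by (simp add: diff_divide_distrib)
    qed
    moreover have "\<gamma> 1 / \<beta> 2 * x + \<gamma> 0 / \<beta> 2 = X / \<beta> 2"
      by (simp add: X_def add_divide_distrib)
    ultimately show "A (family_map \<alpha> \<beta> \<gamma> z) = normal_form a0 (\<alpha> 1) b0 (A z)"
      by (simp add: z A_def family_map_def normal_form_def g2 a2 X_def)
  qed
  ultimately show ?thesis by blast
qed

theorem proposition5: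
  fixes \<alpha> \<beta> \<gamma> :: "nat \<Rightarrow> complex" and f :: plane_map
  assumes "(\<gamma> 1, \<gamma> 2) \<noteq> (0, 0)"
    and "f = family_map \<alpha> \<beta> \<gamma>"
    and "birational f"
    and "\<alpha> 1 * \<gamma> 2 - \<alpha> 2 * \<gamma> 1 = 0"
    and "has_algebraic_entropy f 0"
  shows "(\<exists>A a0 a1 b0. affine_change A \<and> a1 \<noteq> 0 \<and>
            off_curve (\<lambda>z. A (f z) = normal_form a0 a1 b0 (A z))) \<and>
         (\<forall>a0 a1 b0. a1 \<noteq> 0 \<longrightarrow>
            unique_invariant_fibration (normal_form a0 a1 b0) (\<lambda>(x, y). x) \<and>
            (\<forall>p>1. a1 ^ p = 1 \<and> a1 \<noteq> 1 \<longrightarrow>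
               first_integral (normal_form a0 a1 b0)
                 (\<lambda>(x, y). \<Prod>i<p. ((\<lambda>u. a0 + a1 * u) ^^ i) x)) \<and>
            (a1 = 1 \<and> a0 = 0 \<longrightarrow> integrable (normal_form a0 a1 b0)))"
proof
  obtain l where l: "l \<noteq> 0" "\<alpha> 1 = l * \<gamma> 1" "\<alpha> 2 = l * \<gamma> 2"
    and det: "\<beta> 1 * \<gamma> 2 - \<beta> 2 * \<gamma> 1 \<noteq> 0"
    using family_map_nondegenerate[OF assms(1) _ assms(4)] assms(2,3) by blast
  have g2: "\<gamma> 2 = 0"
    using entropy_nonzero[OF l _ det] assms(2,5) by blast
  then have "\<gamma> 1 \<noteq> 0" "\<alpha> 2 = 0" "\<beta> 2 \<noteq> 0" "\<alpha> 1 \<noteq> 0"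
    using assms(1) l det by auto
  then show "\<exists>A a0 a1 b0. affine_change A \<and> a1 \<noteq> 0 \<and>
            off_curve (\<lambda>z. A (f z) = normal_form a0 a1 b0 (A z))"
    using conjugate_to_normal_form[where \<alpha> = \<alpha> and \<beta> = \<beta> and \<gamma> = \<gamma>, OF g2] assms(2) by blast
next
  show "\<forall>a0 a1 b0. a1 \<noteq> 0 \<longrightarrow>
            unique_invariant_fibration (normal_form a0 a1 b0) (\<lambda>(x, y). x) \<and>
            (\<forall>p>1. a1 ^ p = 1 \<and> a1 \<noteq> 1 \<longrightarrow>
               first_integral (normal_form a0 a1 b0)
                 (\<lambda>(x, y). \<Prod>i<p. ((\<lambda>u. a0 + a1 * u) ^^ i) x)) \<and>
            (a1 = 1 \<and> a0 = 0 \<longrightarrow> integrable (normal_form a0 a1 b0))"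
    using unique_fibration_normal_form first_integral_normal_form integrable_normal_form by auto
qed

end
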